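(* Let $K$ be a field of characteristic zero and let $R$ be a commutative Noetherian $K$-algebra which is an integral domain, with a derivation $\delta$ such that $R$ is $\delta$-simple. Suppose there exists $x \in R$ satisfying the following two conditions: (1) there exists a non-maximal prime ideal $P$ of $R$ such that $x \in P$; (2) $\delta(x)$ is an invertible element of $R$ or $x$ is a prime element of $R$. Then $S = R[\theta;\delta]$ does not satisfy $(\diamond)$.
   Context: A derivation of a commutative ring $R$ is an additive map $\delta: R\to R$ with $\delta(ab)=\delta(a)b+a\delta(b)$ (it is not required to be $K$-linear). A $\delta$-ideal is an ideal $I$ of $R$ with $\delta(I)\subseteq I$; $R$ is $\delta$-simple if $0$ and $R$ are its only $\delta$-ideals. The differential operator ring $R[\theta;\delta]$ is the free left $R$-module with basis $1,\theta,\theta^2,\ldots$ with multiplication extending that of $R$ and determined by $\theta a = a\theta+\delta(a)$ for $a\in R$. A Noetherian ring $S$ satisfies property $(\diamond)$ if every cyclic essential extension of a simple $S$-module is Artinian; modules are left modules. *)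

theory Defs
  imports "HOL-Algebra.UnivPoly" "HOL-Algebra.Ring_Divisibility"
begin

section \<open>Derivations and differential operator rings\<close>

locale derivation = cring R for R (structure) +
  fixes \<delta> :: "'a \<Rightarrow> 'a"
  assumes der_closed [simp, intro]: "a \<in> carrier R \<Longrightarrow> \<delta> a \<in> carrier R"
    and der_add: "\<lbrakk>a \<in> carrier R; b \<in> carrier R\<rbrakk> \<Longrightarrow> \<delta> (a \<oplus> b) = \<delta> a \<oplus> \<delta> b"
    and der_mult: "\<lbrakk>a \<in> carrier R; b \<in> carrier R\<rbrakk> \<Longrightarrow> \<delta> (a \<otimes> b) = \<delta> a \<otimes> b \<oplus> a \<otimes> \<delta> b"

context derivation
begin

lemmas a_ac_R = a_assoc a_comm a_lcomm
lemmas r_distr_R = r_distr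

lemma der_zero [simp]: "\<delta> \<zero> = \<zero>"
proof -
  have "\<delta> \<zero> \<oplus> \<delta> \<zero> = \<delta> (\<zero> \<oplus> \<zero>)" by (simp only: der_add zero_closed)
  thus ?thesis by simp
qed

lemma der_one [simp]: "\<delta> \<one> = \<zero>"
proof -
  have "\<delta> \<one> \<oplus> \<delta> \<one> = \<delta> (\<one> \<otimes> \<one>)" by (simp add: der_mult del: l_one r_one) simp
  thus ?thesis by simp
qed

end

definition delta_ideal :: "'a set \<Rightarrow> ('a, 'm) ring_scheme \<Rightarrow> ('a \<Rightarrow> 'a) \<Rightarrow> bool"
  where "delta_ideal I R \<delta> \<longleftrightarrow> ideal I R \<and> \<delta> ` I \<subseteq> I"

definition delta_simple :: "('a, 'm) ring_scheme \<Rightarrow> ('a \<Rightarrow> 'a) \<Rightarrow> bool"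
  where "delta_simple R \<delta> \<longleftrightarrow> (\<forall>I. delta_ideal I R \<delta> \<longrightarrow> I = {\<zero>\<^bsub>R\<^esub>} \<or> I = carrier R)"

text \<open>Left multiplication by \<open>\<theta>\<close>: the rule \<open>\<theta> a = a \<theta> + \<delta>(a)\<close> forces
  \<open>\<theta> (\<Sum>i. b\<^sub>i \<theta>\<^sup>i) = \<Sum>i. (b\<^sub>i \<theta>\<^sup>i\<^sup>+\<^sup>1 + \<delta>(b\<^sub>i) \<theta>\<^sup>i)\<close>.\<close>

definition theta_act :: "('a, 'm) ring_scheme \<Rightarrow> ('a \<Rightarrow> 'a) \<Rightarrow> (nat \<Rightarrow> 'a) \<Rightarrow> nat \<Rightarrow> 'a"
  where "theta_act R \<delta> g =
    (\<lambda>i. (case i of 0 \<Rightarrow> \<zero>\<^bsub>R\<^esub> | Suc j \<Rightarrow> g j) \<oplus>\<^bsub>R\<^esub> \<delta> (g i))"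

text \<open>The differential operator ring \<open>R[\<theta>; \<delta>]\<close>. As a left \<open>R\<close>-module it is the module underlying
  \<^term>\<open>UP R\<close>, i.e. the free module on \<open>1, \<theta>, \<theta>\<^sup>2, \<dots>\<close>, where \<open>\<theta>\<^sup>n\<close> is \<^term>\<open>monom (UP R) \<one>\<^bsub>R\<^esub> n\<close>
  and the function \<open>f\<close> stands for \<open>\<Sum>i. f i \<theta>\<^sup>i\<close>. Only the multiplication is replaced, by
  \<open>(\<Sum>i. a\<^sub>i \<theta>\<^sup>i) g = \<Sum>i. a\<^sub>i (\<theta> (\<theta> (\<dots> (\<theta> g))))\<close>. The lemmas below confirm that this is
  a ring with the defining relations of \<open>R[\<theta>; \<delta>]\<close>.\<close>

definition diff_op_ring :: "('a, 'm) ring_scheme \<Rightarrow> ('a \<Rightarrow> 'a) \<Rightarrow> ('a, nat \<Rightarrow> 'a) up_ring"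
  where "diff_op_ring R \<delta> = (UP R)\<lparr>mult := (\<lambda>f g.
    \<Oplus>\<^bsub>UP R\<^esub>i \<in> {..deg R f}. f i \<odot>\<^bsub>UP R\<^esub> (theta_act R \<delta> ^^ i) g)\<rparr>"

locale diff_op = derivation R \<delta> + UP_cring R P for R (structure) and \<delta> and P (structure)
begin

abbreviation "T \<equiv> theta_act R \<delta>"
abbreviation "S \<equiv> diff_op_ring R \<delta>"

lemma PE: "f \<in> carrier P \<Longrightarrow> f i \<in> carrier R" 
  by (auto simp: P_def UP_def up_def)

lemma coeff_P: "f \<in> carrier P \<Longrightarrow> coeff P f i = f i" 
  by (auto simp: P_def UP_def)

lemma T_closed [simp]: assumes "g \<in> carrier P" shows "T g \<in> carrier P"
proof -
  obtain n where n: "bound \<zero> n g" using assms by (auto simp: P_def UP_def up_def)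
  have "bound \<zero> (Suc n) (T g)"
    using n by (auto simp: bound_def theta_act_def split: nat.split)
  thus ?thesis using PE[OF assms]
    by (auto simp: P_def UP_def up_def theta_act_def split: nat.split)
qed

lemma T_pow_closed [simp]: "g \<in> carrier P \<Longrightarrow> (T ^^ i) g \<in> carrier P"
  by (induction i) auto

lemma P_eqI: "f \<in> carrier P \<Longrightarrow> g \<in> carrier P \<Longrightarrow> (\<And>i. f i = g i) \<Longrightarrow> f = g"
  by auto

lemma add_app: "f \<in> carrier P \<Longrightarrow> g \<in> carrier P \<Longrightarrow> (f \<oplus>\<^bsub>P\<^esub> g) i = f i \<oplus> g i"
  by (auto simp: P_def UP_def)

lemma smult_app: "a \<in> carrier R \<Longrightarrow> g \<in> carrier P \<Longrightarrow> (a \<odot>\<^bsub>P\<^esub> g) i = a \<otimes> g i"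
  by (auto simp: P_def UP_def)

lemma T_add: assumes "f \<in> carrier P" "g \<in> carrier P" shows "T (f \<oplus>\<^bsub>P\<^esub> g) = T f \<oplus>\<^bsub>P\<^esub> T g"
proof (rule P_eqI)
  fix i show "T (f \<oplus>\<^bsub>P\<^esub> g) i = (T f \<oplus>\<^bsub>P\<^esub> T g) i"
    using assms PE[of f] PE[of g]
    by (simp add: add_app[of "T f" "T g"] T_closed) 
       (simp add: theta_act_def add_app der_add a_ac_R split: nat.split)
qed (use assms in auto)

lemma T_smult: assumes "a \<in> carrier R" "g \<in> carrier P"
  shows "T (a \<odot>\<^bsub>P\<^esub> g) = \<delta> a \<odot>\<^bsub>P\<^esub> g \<oplus>\<^bsub>P\<^esub> a \<odot>\<^bsub>P\<^esub> T g"
proof (rule P_eqI)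
  fix i show "T (a \<odot>\<^bsub>P\<^esub> g) i = (\<delta> a \<odot>\<^bsub>P\<^esub> g \<oplus>\<^bsub>P\<^esub> a \<odot>\<^bsub>P\<^esub> T g) i"
    using assms PE[of g]
    by (simp add: add_app smult_app)
       (simp add: theta_act_def smult_app der_mult a_ac_R r_distr_R split: nat.split)
qed (use assms in auto)

lemma T_zero [simp]: "T \<zero>\<^bsub>P\<^esub> = \<zero>\<^bsub>P\<^esub>"
proof -
  have "T \<zero>\<^bsub>P\<^esub> \<oplus>\<^bsub>P\<^esub> T \<zero>\<^bsub>P\<^esub> = T (\<zero>\<^bsub>P\<^esub> \<oplus>\<^bsub>P\<^esub> \<zero>\<^bsub>P\<^esub>)" by (simp only: T_add P.zero_closed)
  thus ?thesis by simp
qed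

lemma T_finsum: "finite A \<Longrightarrow> g \<in> A \<rightarrow> carrier P \<Longrightarrow> T (\<Oplus>\<^bsub>P\<^esub>i\<in>A. g i) = (\<Oplus>\<^bsub>P\<^esub>i\<in>A. T (g i))"
  by (induction A rule: finite_induct) (auto simp: T_add Pi_def)

lemma smult_finsum: "finite A \<Longrightarrow> a \<in> carrier R \<Longrightarrow> g \<in> A \<rightarrow> carrier P \<Longrightarrow>
    a \<odot>\<^bsub>P\<^esub> (\<Oplus>\<^bsub>P\<^esub>i\<in>A. g i) = (\<Oplus>\<^bsub>P\<^esub>i\<in>A. a \<odot>\<^bsub>P\<^esub> g i)"
  by (induction A rule: finite_induct) (auto simp: UP_smult_r_distr Pi_def)

lemma S_simps [simp]: "carrier S = carrier P" "zero S = zero P" "add S = add P" "one S = one P"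
    "smult S = smult P" "monom S = monom P" "coeff S = coeff P"
  by (auto simp: diff_op_ring_def P_def)

lemma finsum_extend:
  assumes "k \<le> (n::nat)" "\<And>i. i \<le> n \<Longrightarrow> g i \<in> carrier P" "\<And>i. k < i \<Longrightarrow> g i = \<zero>\<^bsub>P\<^esub>"
  shows "(\<Oplus>\<^bsub>P\<^esub>i\<in>{..n}. g i) = (\<Oplus>\<^bsub>P\<^esub>i\<in>{..k}. g i)"
  using assms(1,2)
proof (induction n rule: dec_induct)
  case (step n) thus ?case using assms(3)[of "Suc n"] by (auto simp: Pi_def)
qed auto

lemma S_mult:
  assumes "f \<in> carrier P" "g \<in> carrier P" "deg R f \<le> n"
  shows "f \<otimes>\<^bsub>S\<^esub> g = (\<Oplus>\<^bsub>P\<^esub>i\<in>{..n}. f i \<odot>\<^bsub>P\<^esub> (T ^^ i) g)"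
proof -
  have "f i = \<zero>" if "deg R f < i" for i
    using deg_aboveD[OF that assms(1)] coeff_P[OF assms(1)] by simp
  then show ?thesis
    using assms PE[OF assms(1)]
    by (subst finsum_extend[of "deg R f" n]) (auto simp: diff_op_ring_def P_def[symmetric])
qed

lemma mult_closed [simp]: "f \<in> carrier P \<Longrightarrow> g \<in> carrier P \<Longrightarrow> f \<otimes>\<^bsub>S\<^esub> g \<in> carrier P"
  using PE by (subst S_mult) auto

lemma mult_l_distr: assumes "f \<in> carrier P" "g \<in> carrier P" "h \<in> carrier P"
  shows "(f \<oplus>\<^bsub>P\<^esub> g) \<otimes>\<^bsub>S\<^esub> h = f \<otimes>\<^bsub>S\<^esub> h \<oplus>\<^bsub>P\<^esub> g \<otimes>\<^bsub>S\<^esub> h"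
proof -
  define n where "n = max (deg R (f \<oplus>\<^bsub>P\<^esub> g)) (max (deg R f) (deg R g))"
  show ?thesis using assms PE
    by (subst (1 2 3) S_mult[where n = n])
       (auto simp: n_def add_app UP_smult_l_distr P.finsum_addf)
qed

lemma T_pow_add: "f \<in> carrier P \<Longrightarrow> g \<in> carrier P \<Longrightarrow> (T ^^ i) (f \<oplus>\<^bsub>P\<^esub> g) = (T ^^ i) f \<oplus>\<^bsub>P\<^esub> (T ^^ i) g"
  by (induction i) (auto simp: T_add)

lemma mult_r_distr: assumes "f \<in> carrier P" "g \<in> carrier P" "h \<in> carrier P"
  shows "h \<otimes>\<^bsub>S\<^esub> (f \<oplus>\<^bsub>P\<^esub> g) = h \<otimes>\<^bsub>S\<^esub> f \<oplus>\<^bsub>P\<^esub> h \<otimes>\<^bsub>S\<^esub> g"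
  using assms PE
  by (subst (1 2 3) S_mult[OF _ _ order.refl])
     (auto simp: T_pow_add UP_smult_r_distr P.finsum_addf)

lemma smult_mult: assumes "a \<in> carrier R" "f \<in> carrier P" "g \<in> carrier P"
  shows "(a \<odot>\<^bsub>P\<^esub> f) \<otimes>\<^bsub>S\<^esub> g = a \<odot>\<^bsub>P\<^esub> (f \<otimes>\<^bsub>S\<^esub> g)"
  using assms PE deg_smult_decr[of a f]
  by (subst (1 2) S_mult[where n = "deg R f"])
     (auto simp: smult_app UP_smult_assoc1 smult_finsum)

lemma monom_app: "a \<in> carrier R \<Longrightarrow> monom P a n i = (if i = n then a else \<zero>)"
  by (auto simp: P_def UP_def)

lemma monom_mult_S: assumes "a \<in> carrier R" "g \<in> carrier P"
  shows "monom P a n \<otimes>\<^bsub>S\<^esub> g = a \<odot>\<^bsub>P\<^esub> (T ^^ n) g"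
proof -
  have "monom P a n \<otimes>\<^bsub>S\<^esub> g = (\<Oplus>\<^bsub>P\<^esub>i\<in>{..n}. if n = i then a \<odot>\<^bsub>P\<^esub> (T ^^ i) g else \<zero>\<^bsub>P\<^esub>)"
    using assms deg_monom_le[of a n]
    by (subst S_mult[where n = n]) (auto simp: monom_app intro!: P.finsum_cong')
  also have "\<dots> = a \<odot>\<^bsub>P\<^esub> (T ^^ n) g"
    using assms by (subst P.finsum_singleton) auto
  finally show ?thesis .
qed

lemma T_monom: "a \<in> carrier R \<Longrightarrow> T (monom P a n) = monom P a (Suc n) \<oplus>\<^bsub>P\<^esub> monom P (\<delta> a) n"
  by (rule P_eqI, simp, simp) (auto simp: theta_act_def monom_app add_app split: nat.split)

lemma monom_zero [simp]: "monom P \<zero> n = \<zero>\<^bsub>P\<^esub>"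
  by (rule up_eqI) auto

lemma T_pow_one: "(T ^^ i) \<one>\<^bsub>P\<^esub> = monom P \<one> i"
  by (induction i) (auto simp: T_monom)

lemma one_mult: "g \<in> carrier P \<Longrightarrow> \<one>\<^bsub>P\<^esub> \<otimes>\<^bsub>S\<^esub> g = g"
  using monom_mult_S[of \<one> g 0] by simp

lemma mult_one: assumes "f \<in> carrier P" shows "f \<otimes>\<^bsub>S\<^esub> \<one>\<^bsub>P\<^esub> = f"
proof -
  have "f \<otimes>\<^bsub>S\<^esub> \<one>\<^bsub>P\<^esub> = (\<Oplus>\<^bsub>P\<^esub>i\<in>{..deg R f}. monom P (coeff P f i) i)"
    using assms PE[OF assms]
    by (subst S_mult[OF _ _ order.refl])
       (auto simp: T_pow_one coeff_P monom_mult_smult[symmetric] intro!: P.finsum_cong')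
  thus ?thesis using up_repr[OF assms] by simp
qed

lemma finsum_mult: "finite A \<Longrightarrow> h \<in> carrier P \<Longrightarrow> g \<in> A \<rightarrow> carrier P \<Longrightarrow>
    (\<Oplus>\<^bsub>P\<^esub>i\<in>A. g i) \<otimes>\<^bsub>S\<^esub> h = (\<Oplus>\<^bsub>P\<^esub>i\<in>A. g i \<otimes>\<^bsub>S\<^esub> h)"
proof (induction A rule: finite_induct)
  case empty
  have "\<zero>\<^bsub>P\<^esub> \<otimes>\<^bsub>S\<^esub> h = monom P \<zero> 0 \<otimes>\<^bsub>S\<^esub> h" by simp
  also have "\<dots> = \<zero>\<^bsub>P\<^esub>" using empty monom_mult_S[of \<zero> h 0] by simp
  finally show ?case by simp
qed (auto simp: mult_l_distr Pi_def)

lemma T_mult: assumes "f \<in> carrier P" "g \<in> carrier P" shows "T f \<otimes>\<^bsub>S\<^esub> g = T (f \<otimes>\<^bsub>S\<^esub> g)"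
proof -
  let ?m = "\<lambda>i. monom P (f i) i"
  have c: "f i \<in> carrier R" for i using PE assms by auto
  have f: "f = (\<Oplus>\<^bsub>P\<^esub>i\<in>{..deg R f}. ?m i)"
    using up_repr[OF assms(1)] coeff_P[OF assms(1)] by simp
  have m: "T (?m i) \<otimes>\<^bsub>S\<^esub> g = T (?m i \<otimes>\<^bsub>S\<^esub> g)" for i
    using assms c by (simp add: T_monom mult_l_distr monom_mult_S T_smult P.a_comm)
  have "T f \<otimes>\<^bsub>S\<^esub> g = (\<Oplus>\<^bsub>P\<^esub>i\<in>{..deg R f}. T (?m i)) \<otimes>\<^bsub>S\<^esub> g"
    using c by (subst f, subst T_finsum) auto
  also have "\<dots> = (\<Oplus>\<^bsub>P\<^esub>i\<in>{..deg R f}. T (?m i \<otimes>\<^bsub>S\<^esub> g))"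
    using c assms by (simp add: finsum_mult m)
  also have "\<dots> = T ((\<Oplus>\<^bsub>P\<^esub>i\<in>{..deg R f}. ?m i) \<otimes>\<^bsub>S\<^esub> g)"
    using c assms by (simp add: finsum_mult T_finsum)
  finally show ?thesis using f by simp
qed

lemma T_pow_mult: "f \<in> carrier P \<Longrightarrow> g \<in> carrier P \<Longrightarrow> (T ^^ i) f \<otimes>\<^bsub>S\<^esub> g = (T ^^ i) (f \<otimes>\<^bsub>S\<^esub> g)"
  by (induction i) (auto simp: T_mult)

lemma mult_assoc: assumes "f \<in> carrier P" "g \<in> carrier P" "h \<in> carrier P"
  shows "(f \<otimes>\<^bsub>S\<^esub> g) \<otimes>\<^bsub>S\<^esub> h = f \<otimes>\<^bsub>S\<^esub> (g \<otimes>\<^bsub>S\<^esub> h)"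
  using assms PE[OF assms(1)]
  by (simp add: S_mult[of f _ "deg R f"] finsum_mult smult_mult T_pow_mult)

theorem diff_op_ring_ring: "ring S"
proof (rule ringI)
  show "abelian_group S" 
    by (rule abelian_groupI) (auto simp: P.a_assoc P.a_comm P.a_lcomm intro: P.add.l_inv_ex)
  show "monoid S"
    by (rule monoidI) (auto simp: mult_assoc one_mult mult_one)
qed (auto simp: mult_l_distr mult_r_distr)

theorem monom_eq_theta_pow: "a \<in> carrier R \<Longrightarrow> 
    monom S a n = monom S a 0 \<otimes>\<^bsub>S\<^esub> (monom S \<one> 1 [^]\<^bsub>S\<^esub> n)"
proof -
  interpret S: ring S by (rule diff_op_ring_ring)
  have "monom S \<one> 1 [^]\<^bsub>S\<^esub> n = monom P \<one> n"
    by (induction n) (auto simp: T_pow_one[symmetric] T_pow_mult one_mult funpow_swap1)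
  then show "a \<in> carrier R \<Longrightarrow> ?thesis" by (simp add: monom_mult_S monom_mult_smult[symmetric])
qed

theorem const_ring_hom: "(\<lambda>a. monom S a 0) \<in> ring_hom R S"
  by (rule ring_hom_memI) (auto simp: monom_mult_S monom_mult_smult)

theorem theta_commutation:
  "a \<in> carrier R \<Longrightarrow> monom S \<one> 1 \<otimes>\<^bsub>S\<^esub> monom S a 0
     = monom S a 0 \<otimes>\<^bsub>S\<^esub> monom S \<one> 1 \<oplus>\<^bsub>S\<^esub> monom S (\<delta> a) 0"
  by (simp add: monom_mult_S T_monom monom_mult_smult[symmetric])

end

section \<open>Left modules over noncommutative rings\<close>

text \<open>The locale \<^locale>\<open>module\<close> requires a commutative ring of scalars; its notion
  \<^locale>\<open>submodule\<close> does not and is reused.\<close>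

locale left_module = S?: ring S + M?: abelian_group M
    for S :: "('s, 'c) ring_scheme" (structure) and M :: "('s, 'm, 'd) module_scheme" (structure) +
  assumes smult_closed [simp, intro]:
      "\<lbrakk>a \<in> carrier S; x \<in> carrier M\<rbrakk> \<Longrightarrow> a \<odot>\<^bsub>M\<^esub> x \<in> carrier M"
    and smult_l_distr:
      "\<lbrakk>a \<in> carrier S; b \<in> carrier S; x \<in> carrier M\<rbrakk> \<Longrightarrow>
      (a \<oplus>\<^bsub>S\<^esub> b) \<odot>\<^bsub>M\<^esub> x = a \<odot>\<^bsub>M\<^esub> x \<oplus>\<^bsub>M\<^esub> b \<odot>\<^bsub>M\<^esub> x"
    and smult_r_distr:
      "\<lbrakk>a \<in> carrier S; x \<in> carrier M; y \<in> carrier M\<rbrakk> \<Longrightarrow>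
      a \<odot>\<^bsub>M\<^esub> (x \<oplus>\<^bsub>M\<^esub> y) = a \<odot>\<^bsub>M\<^esub> x \<oplus>\<^bsub>M\<^esub> a \<odot>\<^bsub>M\<^esub> y"
    and smult_assoc1:
      "\<lbrakk>a \<in> carrier S; b \<in> carrier S; x \<in> carrier M\<rbrakk> \<Longrightarrow>
      (a \<otimes>\<^bsub>S\<^esub> b) \<odot>\<^bsub>M\<^esub> x = a \<odot>\<^bsub>M\<^esub> (b \<odot>\<^bsub>M\<^esub> x)"
    and smult_one [simp]: "x \<in> carrier M \<Longrightarrow> \<one>\<^bsub>S\<^esub> \<odot>\<^bsub>M\<^esub> x = x"

definition simple_module :: "('s, 'c) ring_scheme \<Rightarrow> ('s, 'm, 'd) module_scheme \<Rightarrow> bool"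
  where "simple_module S M \<longleftrightarrow> left_module S M \<and> carrier M \<noteq> {\<zero>\<^bsub>M\<^esub>} \<and>
    (\<forall>H. submodule H S M \<longrightarrow> H = {\<zero>\<^bsub>M\<^esub>} \<or> H = carrier M)"

definition cyclic_module :: "('s, 'c) ring_scheme \<Rightarrow> ('s, 'm, 'd) module_scheme \<Rightarrow> bool"
  where "cyclic_module S M \<longleftrightarrow> left_module S M \<and>
    (\<exists>m \<in> carrier M. carrier M = (\<lambda>s. s \<odot>\<^bsub>M\<^esub> m) ` carrier S)"

definition artinian_module :: "('s, 'c) ring_scheme \<Rightarrow> ('s, 'm, 'd) module_scheme \<Rightarrow> bool"
  where "artinian_module S M \<longleftrightarrow> left_module S M \<and>
    (\<forall>H :: nat \<Rightarrow> 'm set. (\<forall>n. submodule (H n) S M \<and> H (Suc n) \<subseteq> H n) \<longrightarrow>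
      (\<exists>k. \<forall>n\<ge>k. H n = H k))"

definition essential_submodule ::
    "'m set \<Rightarrow> ('s, 'c) ring_scheme \<Rightarrow> ('s, 'm, 'd) module_scheme \<Rightarrow> bool"
  where "essential_submodule N S M \<longleftrightarrow> submodule N S M \<and>
    (\<forall>H. submodule H S M \<and> H \<noteq> {\<zero>\<^bsub>M\<^esub>} \<longrightarrow> H \<inter> N \<noteq> {\<zero>\<^bsub>M\<^esub>})"

text \<open>Property \<open>(\<diamond>)\<close>, for a ring \<open>S\<close> whose Noetherianness is not part of the predicate. The
  essentially extended simple module is taken, up to isomorphism, to be a submodule.
  A definition cannot quantify over the type of the module elements; the type \<^typ>\<open>'s set\<close> suffices
  because a cyclic module is isomorphic to a quotient of \<open>S\<close>, whose elements are cosets. Lemma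
  \<open>property_diamond_any_type\<close> shows that modules over any other type are covered as well.\<close>

definition property_diamond :: "('s, 'c) ring_scheme \<Rightarrow> bool"
  where "property_diamond S \<longleftrightarrow> (\<forall>(M :: ('s, 's set) module) N.
    cyclic_module S M \<and> essential_submodule N S M \<and> simple_module S (M\<lparr>carrier := N\<rparr>) \<longrightarrow>
    artinian_module S M)"

lemma (in left_module) smult_zero [simp]: "a \<in> carrier S \<Longrightarrow> a \<odot>\<^bsub>M\<^esub> \<zero>\<^bsub>M\<^esub> = \<zero>\<^bsub>M\<^esub>"
  using smult_r_distr[of a "\<zero>\<^bsub>M\<^esub>" "\<zero>\<^bsub>M\<^esub>"] M.add.l_cancel_one'[of "a \<odot>\<^bsub>M\<^esub> \<zero>\<^bsub>M\<^esub>" "a \<odot>\<^bsub>M\<^esub> \<zero>\<^bsub>M\<^esub>"]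
  by (metis M.l_zero M.zero_closed smult_closed)

lemma (in left_module) zero_smult [simp]: "x \<in> carrier M \<Longrightarrow> \<zero>\<^bsub>S\<^esub> \<odot>\<^bsub>M\<^esub> x = \<zero>\<^bsub>M\<^esub>"
  using smult_l_distr[of "\<zero>\<^bsub>S\<^esub>" "\<zero>\<^bsub>S\<^esub>" x] M.add.l_cancel_one'[of "\<zero>\<^bsub>S\<^esub> \<odot>\<^bsub>M\<^esub> x" "\<zero>\<^bsub>S\<^esub> \<odot>\<^bsub>M\<^esub> x"]
  by (metis S.l_zero S.zero_closed smult_closed)

lemma (in left_module) minus_smult:
  assumes "x \<in> carrier M" shows "(\<ominus>\<^bsub>S\<^esub> \<one>\<^bsub>S\<^esub>) \<odot>\<^bsub>M\<^esub> x = \<ominus>\<^bsub>M\<^esub> x"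
proof -
  have "(\<ominus>\<^bsub>S\<^esub> \<one>\<^bsub>S\<^esub>) \<odot>\<^bsub>M\<^esub> x \<oplus>\<^bsub>M\<^esub> x = (\<ominus>\<^bsub>S\<^esub> \<one>\<^bsub>S\<^esub> \<oplus>\<^bsub>S\<^esub> \<one>\<^bsub>S\<^esub>) \<odot>\<^bsub>M\<^esub> x"
    using assms by (subst smult_l_distr) auto
  also have "\<dots> = \<zero>\<^bsub>M\<^esub>" using assms by (simp add: S.l_neg)
  finally show ?thesis using assms by (metis M.minus_equality S.a_inv_closed S.one_closed smult_closed)
qed

lemma (in left_module) submodule_iff:
  "submodule H S M \<longleftrightarrow> H \<subseteq> carrier M \<and> \<zero>\<^bsub>M\<^esub> \<in> H \<and> (\<forall>x\<in>H. \<forall>y\<in>H. x \<oplus>\<^bsub>M\<^esub> y \<in> H) \<and>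
    (\<forall>a\<in>carrier S. \<forall>x\<in>H. a \<odot>\<^bsub>M\<^esub> x \<in> H)"
proof
  assume "submodule H S M"
  then interpret H: submodule H S M .
  show "H \<subseteq> carrier M \<and> \<zero>\<^bsub>M\<^esub> \<in> H \<and> (\<forall>x\<in>H. \<forall>y\<in>H. x \<oplus>\<^bsub>M\<^esub> y \<in> H) \<and>
    (\<forall>a\<in>carrier S. \<forall>x\<in>H. a \<odot>\<^bsub>M\<^esub> x \<in> H)"
    using H.subset H.one_closed H.m_closed H.smult_closed by auto
next
  assume H: "H \<subseteq> carrier M \<and> \<zero>\<^bsub>M\<^esub> \<in> H \<and> (\<forall>x\<in>H. \<forall>y\<in>H. x \<oplus>\<^bsub>M\<^esub> y \<in> H) \<and>
    (\<forall>a\<in>carrier S. \<forall>x\<in>H. a \<odot>\<^bsub>M\<^esub> x \<in> H)"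
  have "\<ominus>\<^bsub>M\<^esub> x \<in> H" if "x \<in> H" for x
    using H that minus_smult[of x] by (metis S.a_inv_closed S.one_closed subsetD)
  with H show "submodule H S M"
    by (intro submodule.intro subgroup.intro submodule_axioms.intro) (auto simp: a_inv_def)
qed

lemma (in left_module) submodule_left_module:
  assumes "submodule N S M" shows "left_module S (M\<lparr>carrier := N\<rparr>)"
proof -
  interpret N: submodule N S M by fact
  have N: "x \<in> carrier M" if "x \<in> N" for x using that N.subset by auto
  have inv: "\<exists>y\<in>N. y \<oplus>\<^bsub>M\<^esub> x = \<zero>\<^bsub>M\<^esub>" if "x \<in> N" for x
    using N.m_inv_closed[OF that] M.l_neg[OF N[OF that]] by (auto simp: a_inv_def)
  have "abelian_group (M\<lparr>carrier := N\<rparr>)"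
    using N.m_closed N.one_closed inv
    by (intro abelian_groupI) (auto simp: M.a_assoc M.a_comm M.a_lcomm N)
  thus ?thesis
    by (intro left_module.intro left_module_axioms.intro S.ring_axioms)
       (auto simp: N smult_l_distr smult_r_distr smult_assoc1)
qed

lemma (in left_module) simple_submodule_iff:
  assumes "submodule N S M"
  shows "simple_module S (M\<lparr>carrier := N\<rparr>) \<longleftrightarrow> N \<noteq> {\<zero>\<^bsub>M\<^esub>} \<and>
    (\<forall>H. submodule H S M \<and> H \<subseteq> N \<longrightarrow> H = {\<zero>\<^bsub>M\<^esub>} \<or> H = N)"
proof -
  interpret N: left_module S "M\<lparr>carrier := N\<rparr>" by (rule submodule_left_module[OF assms])
  have "submodule H S (M\<lparr>carrier := N\<rparr>) \<longleftrightarrow> submodule H S M \<and> H \<subseteq> N" for H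
    using assms unfolding submodule_iff N.submodule_iff by auto
  thus ?thesis using N.left_module_axioms unfolding simple_module_def by auto
qed

locale module_transport = left_module S M
  for S :: "('s, 'c) ring_scheme" (structure) and M :: "('s, 'm, 'd) module_scheme" (structure) +
  fixes g :: "'m \<Rightarrow> 'n"
  assumes inj: "inj_on g (carrier M)"
begin

definition h :: "'n \<Rightarrow> 'm" where "h = the_inv_into (carrier M) g"

definition M' :: "('s, 'n) module" where
  "M' = \<lparr>carrier = g ` carrier M, mult = undefined, one = undefined, zero = g \<zero>\<^bsub>M\<^esub>,
    add = (\<lambda>A B. g (h A \<oplus>\<^bsub>M\<^esub> h B)), smult = (\<lambda>s A. g (s \<odot>\<^bsub>M\<^esub> h A))\<rparr>"

lemma hg [simp]: "x \<in> carrier M \<Longrightarrow> h (g x) = x"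
  using inj by (simp add: h_def the_inv_into_f_f)

lemma g_eq: "x \<in> carrier M \<Longrightarrow> y \<in> carrier M \<Longrightarrow> g x = g y \<longleftrightarrow> x = y"
  using inj by (auto dest: inj_onD)

lemma left_module_M': "left_module S M'"
proof -
  have "\<exists>y\<in>carrier M. y \<oplus>\<^bsub>M\<^esub> x = \<zero>\<^bsub>M\<^esub>" if "x \<in> carrier M" for x
    using M.l_neg[OF that] that by blast
  then have "abelian_group M'"
    by (intro abelian_groupI) (auto simp: M'_def M.a_assoc M.a_comm M.a_lcomm g_eq)
  thus ?thesis
    by (intro left_module.intro left_module_axioms.intro S.ring_axioms)
       (auto simp: M'_def smult_l_distr smult_r_distr smult_assoc1)
qed

sublocale M': left_module S M' by (rule left_module_M')

lemma g_image_eq: "A \<subseteq> carrier M \<Longrightarrow> B \<subseteq> carrier M \<Longrightarrow> g ` A = g ` B \<longleftrightarrow> A = B"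
  using inj by (rule inj_on_image_eq_iff)

lemma submodule_image: assumes "H \<subseteq> carrier M" shows "submodule (g ` H) S M' \<longleftrightarrow> submodule H S M"
proof -
  have mem: "g x \<in> g ` H \<longleftrightarrow> x \<in> H" if "x \<in> carrier M" for x
    using assms that inj by (auto dest: inj_onD)
  have "x \<oplus>\<^bsub>M\<^esub> y \<in> carrier M" "a \<in> carrier S \<Longrightarrow> a \<odot>\<^bsub>M\<^esub> x \<in> carrier M" "h (g x) = x"
    if "x \<in> H" "y \<in> H" for x y a using that assms by auto
  then show ?thesis
    using assms unfolding submodule_iff M'.submodule_iff by (auto simp: M'_def mem)
qed

lemma submodule_M'_cases: 
  assumes "submodule H' S M'" obtains H where "H \<subseteq> carrier M" "H' = g ` H" "submodule H S M"
proof -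
  have "H' \<subseteq> g ` carrier M" using assms unfolding M'.submodule_iff by (simp add: M'_def)
  then obtain H where "H \<subseteq> carrier M" "H' = g ` H" by (meson subset_imageE)
  with assms submodule_image that show thesis by auto
qed

lemma transport_zero: "zero M' = g \<zero>\<^bsub>M\<^esub>" by (simp add: M'_def)

lemma cyclic_M': assumes "cyclic_module S M" shows "cyclic_module S M'"
proof -
  obtain m where m: "m \<in> carrier M" "carrier M = (\<lambda>s. s \<odot>\<^bsub>M\<^esub> m) ` carrier S"
    using assms by (auto simp: cyclic_module_def)
  have "carrier M' = g ` (\<lambda>s. s \<odot>\<^bsub>M\<^esub> m) ` carrier S" using m(2) by (simp add: M'_def)
  also have "\<dots> = (\<lambda>s. s \<odot>\<^bsub>M'\<^esub> g m) ` carrier S"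
    using m(1) by (auto simp: M'_def image_image)
  finally have "carrier M' = (\<lambda>s. s \<odot>\<^bsub>M'\<^esub> g m) ` carrier S" .
  moreover have "g m \<in> carrier M'" using m(1) by (simp add: M'_def)
  ultimately show ?thesis using left_module_M' unfolding cyclic_module_def by blast
qed

lemma sub_zero_image: "H \<subseteq> carrier M \<Longrightarrow> g ` H = {zero M'} \<longleftrightarrow> H = {\<zero>\<^bsub>M\<^esub>}"
  using g_image_eq[of H "{\<zero>\<^bsub>M\<^esub>}"] by (simp add: transport_zero)

lemma essential_M': assumes "essential_submodule N S M" shows "essential_submodule (g ` N) S M'"
proof -
  have N: "submodule N S M" "N \<subseteq> carrier M"
    using assms by (auto simp: essential_submodule_def submodule_iff)
  have "H' \<inter> g ` N \<noteq> {zero M'}" if H': "submodule H' S M'" "H' \<noteq> {zero M'}" for H'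
  proof -
    obtain H where H: "H \<subseteq> carrier M" "H' = g ` H" "submodule H S M"
      using submodule_M'_cases[OF H'(1)] .
    have "g ` H \<inter> g ` N = g ` (H \<inter> N)" using inj_on_image_Int[OF inj H(1) N(2)] by simp
    moreover have "H \<inter> N \<noteq> {\<zero>\<^bsub>M\<^esub>}"
      using H H'(2) sub_zero_image[OF H(1)] assms by (auto simp: essential_submodule_def)
    ultimately show ?thesis using sub_zero_image[of "H \<inter> N"] H by auto
  qed
  thus ?thesis using submodule_image[OF N(2)] N(1) by (auto simp: essential_submodule_def)
qed

lemma simple_M':
  assumes N: "submodule N S M" and "simple_module S (M\<lparr>carrier := N\<rparr>)"
  shows "simple_module S (M'\<lparr>carrier := g ` N\<rparr>)"
proof -
  have Nc: "N \<subseteq> carrier M" using N by (simp add: submodule_iff)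
  have s: "N \<noteq> {\<zero>\<^bsub>M\<^esub>}" "\<And>H. submodule H S M \<Longrightarrow> H \<subseteq> N \<Longrightarrow> H = {\<zero>\<^bsub>M\<^esub>} \<or> H = N"
    using assms by (auto simp: simple_submodule_iff)
  have "H' = {zero M'} \<or> H' = g ` N" if H': "submodule H' S M'" "H' \<subseteq> g ` N" for H'
  proof -
    obtain H where H: "H \<subseteq> carrier M" "H' = g ` H" "submodule H S M"
      using submodule_M'_cases[OF H'(1)] .
    have "H \<subseteq> N" using H'(2) H(1,2) Nc g_eq by (auto simp: image_subset_iff image_iff subset_iff)
    with s(2)[OF H(3)] H(2) show ?thesis by (auto simp: transport_zero)
  qed
  moreover have "submodule (g ` N) S M'" using N submodule_image[OF Nc] by simp
  ultimately show ?thesis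
    using s(1) sub_zero_image[OF Nc] by (auto simp: M'.simple_submodule_iff)
qed

lemma artinian_M': assumes "artinian_module S M'" shows "artinian_module S M"
proof -
  have "\<exists>k. \<forall>n\<ge>k. H n = H k" if H: "\<And>n. submodule (H n) S M \<and> H (Suc n) \<subseteq> H n" for H :: "nat \<Rightarrow> _"
  proof -
    have c: "H n \<subseteq> carrier M" for n using H[of n] by (simp add: submodule_iff)
    have d: "\<forall>n. submodule (g ` H n) S M' \<and> g ` H (Suc n) \<subseteq> g ` H n"
      using H submodule_image[OF c] by (auto intro!: image_mono)
    have "\<exists>k. \<forall>n\<ge>k. g ` H n = g ` H k"
      using assms[unfolded artinian_module_def, THEN conjunct2, THEN spec, of "\<lambda>n. g ` H n"] d
      by simp
    then obtain k where "\<forall>n\<ge>k. g ` H n = g ` H k" by blast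
    thus ?thesis using g_image_eq[OF c c] by blast
  qed
  thus ?thesis using left_module_axioms by (auto simp: artinian_module_def)
qed

end

theorem property_diamond_any_type:
  fixes S :: "('s, 'c) ring_scheme" and M :: "('s, 'm, 'd) module_scheme"
  assumes "property_diamond S" "cyclic_module S M" "essential_submodule N S M"
    "simple_module S (M\<lparr>carrier := N\<rparr>)"
  shows "artinian_module S M"
proof -
  interpret left_module S M using assms(2) by (simp add: cyclic_module_def)
  obtain m where m: "m \<in> carrier M" "carrier M = (\<lambda>s. s \<odot>\<^bsub>M\<^esub> m) ` carrier S"
    using assms(2) by (auto simp: cyclic_module_def)
  define g where "g y = {s \<in> carrier S. s \<odot>\<^bsub>M\<^esub> m = y}" for y
  have "inj_on g (carrier M)"
  proof (rule inj_onI)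
    fix y z assume y: "y \<in> carrier M" and eq: "g y = g z"
    obtain s where "s \<in> carrier S" "y = s \<odot>\<^bsub>M\<^esub> m" using y m(2) by auto
    then have "s \<in> g y" by (simp add: g_def)
    with eq show "y = z" by (auto simp: g_def)
  qed
  then interpret module_transport S M g by unfold_locales
  have "artinian_module S M'"
    using assms cyclic_M' essential_M' simple_M' unfolding property_diamond_def
    by (metis essential_submodule_def)
  thus ?thesis by (rule artinian_M')
qed

end

theory Submission
  imports Defs
begin

text \<open>The field of fractions of \<open>R\<close> is an \<open>S\<close>-module with \<open>\<theta>\<close> acting by the quotient rule. Its
  submodule \<open>R\<close> is simple because \<open>R\<close> is \<open>\<delta>\<close>-simple, and it is essential because denominators can be
  cleared. So \<open>S \<cdot> (1 / x)\<close> is a cyclic essential extension of \<open>R\<close>, and it remains to see that it is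
  not Artinian. Choose \<open>b \<notin> P\<close> such that \<open>P + b R\<close> is contained in a proper ideal, and let
  \<open>Q\<^sub>n = P + b\<^sup>n R\<close>. The submodules \<open>S Q\<^sub>n \<cdot> (1 / x)\<close> decrease strictly:
  modulo lower poles the \<open>n\<close>-th derivative of \<open>q / x\<close> is \<open>(-1)\<^sup>n n! \<delta>(x)\<^sup>n q / x\<^sup>n\<^sup>+\<^sup>1\<close>, where \<open>n!\<close> is
  invertible and \<open>\<delta>(x)\<close> is a nonzerodivisor modulo \<open>x\<close>, and comparing poles shows that \<open>b\<^sup>n / x\<close>
  can only lie in \<open>S Q \<cdot> (1 / x)\<close> if \<open>b\<^sup>n \<in> Q\<close>, for any ideal \<open>Q\<close> containing \<open>x\<close>.\<close>

section \<open>Differential modules as modules over \<open>R[\<theta>; \<delta>]\<close>\<close>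

text \<open>The Leibniz rule \<open>D_smult\<close> is the relation \<theta> a = a \<theta> +
  \<delta>(a) read as an identity of operators on \<open>V\<close>, so these data amount to a left
  \<open>S\<close>-module on which \<theta> acts as \<open>D\<close>.\<close>

locale differential_module = diff_op + V: module R V for V (structure) +
  fixes D :: "'c \<Rightarrow> 'c"
  assumes D_closed [simp, intro]: "v \<in> carrier V \<Longrightarrow> D v \<in> carrier V"
    and D_add: "\<lbrakk>v \<in> carrier V; w \<in> carrier V\<rbrakk> \<Longrightarrow> D (v \<oplus>\<^bsub>V\<^esub> w) = D v \<oplus>\<^bsub>V\<^esub> D w"
    and D_smult: "\<lbrakk>a \<in> carrier R; v \<in> carrier V\<rbrakk> \<Longrightarrow>
      D (a \<odot>\<^bsub>V\<^esub> v) = \<delta> a \<odot>\<^bsub>V\<^esub> v \<oplus>\<^bsub>V\<^esub> a \<odot>\<^bsub>V\<^esub> D v"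
begin

definition act :: "(nat \<Rightarrow> 'a) \<Rightarrow> 'c \<Rightarrow> 'c"
  where "act f v = (\<Oplus>\<^bsub>V\<^esub>i\<in>{..deg R f}. f i \<odot>\<^bsub>V\<^esub> (D ^^ i) v)"

definition diff_mod :: "(nat \<Rightarrow> 'a, 'c) module"
  where "diff_mod = \<lparr>carrier = carrier V, mult = undefined, one = undefined, zero = \<zero>\<^bsub>V\<^esub>,
    add = add V, smult = act\<rparr>"

lemma D_pow_closed [simp]: "v \<in> carrier V \<Longrightarrow> (D ^^ i) v \<in> carrier V"
  by (induction i) auto

lemma D_zero [simp]: "D \<zero>\<^bsub>V\<^esub> = \<zero>\<^bsub>V\<^esub>"
  using D_smult[of \<zero> "\<zero>\<^bsub>V\<^esub>"] by simp

lemma D_pow_add: "v \<in> carrier V \<Longrightarrow> w \<in> carrier V \<Longrightarrow> (D ^^ i) (v \<oplus>\<^bsub>V\<^esub> w) = (D ^^ i) v \<oplus>\<^bsub>V\<^esub> (D ^^ i) w"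
  by (induction i) (auto simp: D_add)

lemma D_finsum: "finite A \<Longrightarrow> g \<in> A \<rightarrow> carrier V \<Longrightarrow> D (\<Oplus>\<^bsub>V\<^esub>i\<in>A. g i) = (\<Oplus>\<^bsub>V\<^esub>i\<in>A. D (g i))"
  by (induction A rule: finite_induct) (auto simp: D_add Pi_def)

lemma V_smult_finsum: "finite A \<Longrightarrow> a \<in> carrier R \<Longrightarrow> g \<in> A \<rightarrow> carrier V \<Longrightarrow>
    a \<odot>\<^bsub>V\<^esub> (\<Oplus>\<^bsub>V\<^esub>i\<in>A. g i) = (\<Oplus>\<^bsub>V\<^esub>i\<in>A. a \<odot>\<^bsub>V\<^esub> g i)"
  by (induction A rule: finite_induct) (auto simp: V.smult_r_distr Pi_def)

lemma V_finsum_extend: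
  assumes "k \<le> (n::nat)" "\<And>i. i \<le> n \<Longrightarrow> g i \<in> carrier V" "\<And>i. k < i \<Longrightarrow> g i = \<zero>\<^bsub>V\<^esub>"
  shows "(\<Oplus>\<^bsub>V\<^esub>i\<in>{..n}. g i) = (\<Oplus>\<^bsub>V\<^esub>i\<in>{..k}. g i)"
  using assms(1,2)
proof (induction n rule: dec_induct)
  case (step n) thus ?case using assms(3)[of "Suc n"] by (auto simp: Pi_def)
qed auto

text \<open>Coefficients beyond the degree vanish, so the defining sum may run to any larger bound.
  This gives operators of different degrees a common summation range.\<close>

lemma act_bound:
  assumes "f \<in> carrier P" "v \<in> carrier V" "deg R f \<le> n"
  shows "act f v = (\<Oplus>\<^bsub>V\<^esub>i\<in>{..n}. f i \<odot>\<^bsub>V\<^esub> (D ^^ i) v)"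
proof -
  have "f i = \<zero>" if "deg R f < i" for i
    using deg_aboveD[OF that assms(1)] coeff_P[OF assms(1)] by simp
  then show ?thesis
    using assms PE[OF assms(1)]
    by (subst V_finsum_extend[of "deg R f" n]) (auto simp: act_def)
qed

lemma act_closed [simp]: "f \<in> carrier P \<Longrightarrow> v \<in> carrier V \<Longrightarrow> act f v \<in> carrier V"
  using PE by (subst act_bound) auto

lemma act_l_distr: assumes "f \<in> carrier P" "g \<in> carrier P" "v \<in> carrier V"
  shows "act (f \<oplus>\<^bsub>P\<^esub> g) v = act f v \<oplus>\<^bsub>V\<^esub> act g v"
proof -
  define n where "n = max (deg R (f \<oplus>\<^bsub>P\<^esub> g)) (max (deg R f) (deg R g))"
  show ?thesis using assms PE
    by (subst (1 2 3) act_bound[where n = n])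
       (auto simp: n_def add_app V.smult_l_distr V.M.finsum_addf)
qed

lemma act_r_distr: assumes "f \<in> carrier P" "v \<in> carrier V" "w \<in> carrier V"
  shows "act f (v \<oplus>\<^bsub>V\<^esub> w) = act f v \<oplus>\<^bsub>V\<^esub> act f w"
  using assms PE
  by (subst (1 2 3) act_bound[OF _ _ order.refl])
     (auto simp: D_pow_add V.smult_r_distr V.M.finsum_addf)

lemma act_smult: assumes "a \<in> carrier R" "f \<in> carrier P" "v \<in> carrier V"
  shows "act (a \<odot>\<^bsub>P\<^esub> f) v = a \<odot>\<^bsub>V\<^esub> act f v"
  using assms PE deg_smult_decr[of a f]
  by (subst (1 2) act_bound[where n = "deg R f"])
     (auto simp: smult_app V.smult_assoc1 V_smult_finsum)

lemma act_monom: assumes "a \<in> carrier R" "v \<in> carrier V"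
  shows "act (monom P a n) v = a \<odot>\<^bsub>V\<^esub> (D ^^ n) v"
proof -
  have "act (monom P a n) v = (\<Oplus>\<^bsub>V\<^esub>i\<in>{..n}. if n = i then a \<odot>\<^bsub>V\<^esub> (D ^^ i) v else \<zero>\<^bsub>V\<^esub>)"
    using assms deg_monom_le[of a n]
    by (subst act_bound[where n = n]) (auto simp: monom_app intro!: V.M.finsum_cong')
  also have "\<dots> = a \<odot>\<^bsub>V\<^esub> (D ^^ n) v"
    using assms by (subst V.M.finsum_singleton) auto
  finally show ?thesis .
qed

lemma act_zero: "v \<in> carrier V \<Longrightarrow> act \<zero>\<^bsub>P\<^esub> v = \<zero>\<^bsub>V\<^esub>"
  using act_monom[of \<zero> v 0] by simp

lemma act_finsum: "finite A \<Longrightarrow> v \<in> carrier V \<Longrightarrow> g \<in> A \<rightarrow> carrier P \<Longrightarrow>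
    act (\<Oplus>\<^bsub>P\<^esub>i\<in>A. g i) v = (\<Oplus>\<^bsub>V\<^esub>i\<in>A. act (g i) v)"
  by (induction A rule: finite_induct) (auto simp: act_zero act_l_distr Pi_def)

text \<open>By additivity it suffices to treat a monomial, where the two summands of
  \<open>T_monom\<close> match the two summands of \<open>D_smult\<close>.\<close>

lemma act_T: assumes "f \<in> carrier P" "v \<in> carrier V" shows "act (T f) v = D (act f v)"
proof -
  let ?m = "\<lambda>i. monom P (f i) i"
  have c: "f i \<in> carrier R" for i using PE assms by auto
  have f: "f = (\<Oplus>\<^bsub>P\<^esub>i\<in>{..deg R f}. ?m i)"
    using up_repr[OF assms(1)] coeff_P[OF assms(1)] by simp
  have m: "act (T (?m i)) v = D (act (?m i) v)" for i
    using assms c by (simp add: T_monom act_l_distr act_monom D_smult V.M.a_comm)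
  have "act (T f) v = (\<Oplus>\<^bsub>V\<^esub>i\<in>{..deg R f}. act (T (?m i)) v)"
    using c assms by (subst f, subst T_finsum) (auto simp: act_finsum)
  also have "\<dots> = D (act (\<Oplus>\<^bsub>P\<^esub>i\<in>{..deg R f}. ?m i) v)"
    using c assms by (simp add: act_finsum D_finsum m)
  finally show ?thesis using f by simp
qed

lemma act_T_pow: "f \<in> carrier P \<Longrightarrow> v \<in> carrier V \<Longrightarrow> act ((T ^^ i) f) v = (D ^^ i) (act f v)"
  by (induction i) (auto simp: act_T)

text \<open>The product in \<open>S\<close> is a combination of iterates of \<open>T\<close>, each
  of which \<open>act_T_pow\<close> turns into an iterate of \<open>D\<close>.\<close>

lemma act_mult: assumes "f \<in> carrier P" "g \<in> carrier P" "v \<in> carrier V"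
  shows "act (f \<otimes>\<^bsub>S\<^esub> g) v = act f (act g v)"
  using assms PE[OF assms(1)]
  by (simp add: S_mult[of f _ "deg R f"] act_bound[of f _ "deg R f"] act_finsum act_smult act_T_pow)

lemma diff_mod_simps [simp]: "carrier diff_mod = carrier V" "zero diff_mod = \<zero>\<^bsub>V\<^esub>"
    "add diff_mod = add V" "smult diff_mod = act"
  by (auto simp: diff_mod_def)

lemma act_one: "v \<in> carrier V \<Longrightarrow> act \<one>\<^bsub>P\<^esub> v = v"
  using act_monom[of \<one> v 0] by simp

theorem left_module_diff_mod: "left_module S diff_mod"
proof -
  have "abelian_group diff_mod"
    by (intro abelian_groupI) 
      (auto simp: V.M.a_assoc V.M.a_comm V.M.a_lcomm intro: V.M.add.l_inv_ex)
  then show ?thesis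
    by (intro left_module.intro left_module_axioms.intro diff_op_ring_ring)
       (auto simp: act_l_distr act_r_distr act_mult act_one)
qed

text \<open>\<open>S\<close> is generated by the constants and \<theta>, so stability under scalars
  from \<open>R\<close> and under \<open>D\<close> already gives stability under every
  operator.\<close>

lemma submodule_diff_mod_iff:
  "submodule H S diff_mod \<longleftrightarrow> H \<subseteq> carrier V \<and> \<zero>\<^bsub>V\<^esub> \<in> H \<and> (\<forall>v\<in>H. \<forall>w\<in>H. v \<oplus>\<^bsub>V\<^esub> w \<in> H) \<and>
    (\<forall>a\<in>carrier R. \<forall>v\<in>H. a \<odot>\<^bsub>V\<^esub> v \<in> H) \<and> (\<forall>v\<in>H. D v \<in> H)" (is "_ \<longleftrightarrow> ?rhs")
proof
  assume H: "submodule H S diff_mod"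
  have HV: "H \<subseteq> carrier V" and z: "\<zero>\<^bsub>V\<^esub> \<in> H" and add: "\<And>v w. v \<in> H \<Longrightarrow> w \<in> H \<Longrightarrow> v \<oplus>\<^bsub>V\<^esub> w \<in> H"
    and act: "\<And>f v. f \<in> carrier P \<Longrightarrow> v \<in> H \<Longrightarrow> act f v \<in> H"
    using H by (simp_all add: left_module.submodule_iff[OF left_module_diff_mod])
  have "a \<odot>\<^bsub>V\<^esub> v \<in> H" if "a \<in> carrier R" "v \<in> H" for a v
    using act[of "monom P a 0" v] that HV by (simp add: act_monom subset_iff)
  moreover have "D v \<in> H" if "v \<in> H" for v
    using act[of "monom P \<one> 1" v] that HV by (simp add: act_monom subset_iff)
  ultimately show ?rhs using HV z add by blast
next
  assume H: ?rhs
  have pow: "(D ^^ i) v \<in> H" if "v \<in> H" for i v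
    using H that by (induction i) auto
  have sum: "(\<Oplus>\<^bsub>V\<^esub>i\<in>I. g i) \<in> H" if "finite I" "g \<in> I \<rightarrow> H" for g and I :: "nat set"
    using that
  proof (induction I rule: finite_induct)
    case (insert i I)
    then have "g \<in> I \<rightarrow> carrier V" "g i \<in> carrier V" using H by auto
    with insert H show ?case by simp
  qed (use H in simp)
  have "act f v \<in> H" if "f \<in> carrier P" "v \<in> H" for f v
    unfolding act_def using that H pow PE by (intro sum) auto
  then show "submodule H S diff_mod"
    using H by (simp add: left_module.submodule_iff[OF left_module_diff_mod])
qed

end

section \<open>A criterion for the failure of the diamond property\<close>

lemma (in left_module) submodule_restrict_iff:
  assumes "submodule N S M"
  shows "submodule H S (M\<lparr>carrier := N\<rparr>) \<longleftrightarrow> submodule H S M \<and> H \<subseteq> N"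
proof -
  interpret N: left_module S "M\<lparr>carrier := N\<rparr>" by (rule submodule_left_module[OF assms])
  show ?thesis using assms unfolding submodule_iff N.submodule_iff by auto
qed

lemma (in left_module) submodule_orbit:
  assumes "m \<in> carrier M" shows "submodule ((\<lambda>s. s \<odot>\<^bsub>M\<^esub> m) ` carrier S) S M"
  unfolding submodule_iff
proof (intro conjI ballI)
  show "\<zero>\<^bsub>M\<^esub> \<in> (\<lambda>s. s \<odot>\<^bsub>M\<^esub> m) ` carrier S"
    using assms by (intro image_eqI[of _ _ "\<zero>\<^bsub>S\<^esub>"]) auto
  fix v assume v: "v \<in> (\<lambda>s. s \<odot>\<^bsub>M\<^esub> m) ` carrier S"
  then obtain s where s: "s \<in> carrier S" "v = s \<odot>\<^bsub>M\<^esub> m" by auto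
  show "a \<odot>\<^bsub>M\<^esub> v \<in> (\<lambda>s. s \<odot>\<^bsub>M\<^esub> m) ` carrier S" if "a \<in> carrier S" for a
    using that s assms by (intro image_eqI[of _ _ "a \<otimes>\<^bsub>S\<^esub> s"]) (simp_all add: smult_assoc1)
  fix w assume "w \<in> (\<lambda>s. s \<odot>\<^bsub>M\<^esub> m) ` carrier S"
  then obtain t where "t \<in> carrier S" "w = t \<odot>\<^bsub>M\<^esub> m" by auto
  with s assms show "v \<oplus>\<^bsub>M\<^esub> w \<in> (\<lambda>s. s \<odot>\<^bsub>M\<^esub> m) ` carrier S"
    by (intro image_eqI[of _ _ "s \<oplus>\<^bsub>S\<^esub> t"]) (simp_all add: smult_l_distr)
qed (use assms in auto)

text \<open>All data live in an ambient module \<open>M\<close>, and the orbit \<open>C\<close> of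
  \<open>m\<close> serves as the cyclic extension. Essentiality of \<open>N\<close> in
  \<open>M\<close> passes to \<open>C\<close>, the chain \<open>H\<close> prevents \<open>C\<close>
  from being Artinian, and \<open>property_diamond_any_type\<close> takes care of the element
  type.\<close>

lemma (in left_module) not_property_diamondI:
  fixes H :: "nat \<Rightarrow> _"
  assumes m: "m \<in> carrier M" and C: "C = (\<lambda>s. s \<odot>\<^bsub>M\<^esub> m) ` carrier S"
    and N: "submodule N S M" "N \<subseteq> C" "simple_module S (M\<lparr>carrier := N\<rparr>)"
    and ess: "\<And>H. submodule H S M \<Longrightarrow> H \<noteq> {\<zero>\<^bsub>M\<^esub>} \<Longrightarrow> H \<inter> N \<noteq> {\<zero>\<^bsub>M\<^esub>}"
    and H: "\<And>n. submodule (H n) S M" "\<And>n. H n \<subseteq> C" "\<And>n. H (Suc n) \<subset> H n"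
  shows "\<not> property_diamond S"
proof
  assume dia: "property_diamond S"
  let ?C = "M\<lparr>carrier := C\<rparr>"
  have subC: "submodule C S M" unfolding C by (rule submodule_orbit[OF m])
  interpret C: left_module S ?C by (rule submodule_left_module[OF subC])
  have "m \<in> C" unfolding C using m by (intro image_eqI[of _ _ "\<one>\<^bsub>S\<^esub>"]) auto
  then have "cyclic_module S ?C"
    using C.left_module_axioms C unfolding cyclic_module_def
    by (intro conjI bexI[of _ m]) simp_all
  moreover have "essential_submodule N S ?C"
    using N ess by (auto simp: essential_submodule_def submodule_restrict_iff[OF subC])
  moreover have "simple_module S (?C\<lparr>carrier := N\<rparr>)" using N(3) by simp
  ultimately have "artinian_module S ?C" by (rule property_diamond_any_type[OF dia])
  moreover have "\<forall>n. submodule (H n) S ?C \<and> H (Suc n) \<subseteq> H n"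
    using H by (simp add: submodule_restrict_iff[OF subC] less_imp_le)
  ultimately obtain k where k: "\<And>n. n \<ge> k \<Longrightarrow> H n = H k"
    unfolding artinian_module_def by metis
  have "H (Suc k) = H k" by (rule k) simp
  with H(3)[of k] show False by simp
qed

section \<open>The field of fractions as a module\<close>

context domain
begin

text \<open>A fraction is encoded as its full class of pairs under cross multiplication, so that
  equality of fractions is equality of sets.\<close>

definition frac :: "'a \<Rightarrow> 'a \<Rightarrow> ('a \<times> 'a) set"
  where "frac a b = {(c, d). c \<in> carrier R \<and> d \<in> carrier R - {\<zero>} \<and> a \<otimes> d = c \<otimes> b}"

text \<open>Evaluates \<open>F\<close> at an arbitrarily chosen representative; the result is
  meaningful when \<open>F\<close> is constant on the class.\<close>

definition frac_lift :: "('a \<Rightarrow> 'a \<Rightarrow> 'x) \<Rightarrow> ('a \<times> 'a) set \<Rightarrow> 'x"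
  where "frac_lift F X = case_prod F (SOME p. p \<in> X)"

definition fracs :: "('a, ('a \<times> 'a) set) module"
  where "fracs = \<lparr>carrier = {frac a b | a b. a \<in> carrier R \<and> b \<in> carrier R - {\<zero>}},
    mult = undefined, one = undefined, zero = frac \<zero> \<one>,
    add = (\<lambda>X Y. frac_lift (\<lambda>a b. frac_lift (\<lambda>c d. frac (a \<otimes> d \<oplus> c \<otimes> b) (b \<otimes> d)) Y) X),
    smult = (\<lambda>r. frac_lift (\<lambda>a b. frac (r \<otimes> a) b))\<rparr>"

text \<open>One direction tests both classes on the pair \<open>(c, d)\<close>. The other is
  transitivity of cross multiplication, which holds because nonzero factors cancel in a
  domain.\<close>

lemma frac_eq_iff:
  assumes "a \<in> carrier R" "b \<in> carrier R - {\<zero>}" "c \<in> carrier R" "d \<in> carrier R - {\<zero>}"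
  shows "frac a b = frac c d \<longleftrightarrow> a \<otimes> d = c \<otimes> b"
proof
  assume "frac a b = frac c d"
  moreover have "(c, d) \<in> frac c d" using assms by (simp add: frac_def)
  ultimately have "(c, d) \<in> frac a b" by simp
  then show "a \<otimes> d = c \<otimes> b" by (simp add: frac_def)
next
  assume eq: "a \<otimes> d = c \<otimes> b"
  have "a \<otimes> f = e \<otimes> b \<longleftrightarrow> c \<otimes> f = e \<otimes> d" if ef: "e \<in> carrier R" "f \<in> carrier R" for e f
  proof -
    have "a \<otimes> f = e \<otimes> b \<longleftrightarrow> d \<otimes> (a \<otimes> f) = d \<otimes> (e \<otimes> b)"
      using assms ef by (simp add: m_lcancel)
    also have "d \<otimes> (a \<otimes> f) = b \<otimes> (c \<otimes> f)"
      using assms ef eq by (metis DiffD1 m_assoc m_comm)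
    also have "d \<otimes> (e \<otimes> b) = b \<otimes> (e \<otimes> d)"
      using assms ef by (simp add: m_ac)
    finally show ?thesis using assms ef by (simp add: m_lcancel)
  qed
  then show "frac a b = frac c d" by (auto simp: frac_def)
qed

lemma frac_cancel:
  assumes "a \<in> carrier R" "b \<in> carrier R - {\<zero>}" "c \<in> carrier R - {\<zero>}"
  shows "frac (a \<otimes> c) (b \<otimes> c) = frac a b"
  using assms by (subst frac_eq_iff) (auto simp: integral_iff m_ac)

text \<open>Invariance under expanding the fraction is enough for well-definedness, because two equal
  fractions have a common expansion.\<close>

lemma frac_lift_frac:
  assumes F: "\<And>a b c. \<lbrakk>a \<in> carrier R; b \<in> carrier R - {\<zero>}; c \<in> carrier R - {\<zero>}\<rbrakk> \<Longrightarrow>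
      F (a \<otimes> c) (b \<otimes> c) = F a b"
    and ab: "a \<in> carrier R" "b \<in> carrier R - {\<zero>}"
  shows "frac_lift F (frac a b) = F a b"
proof -
  have "(a, b) \<in> frac a b" using ab by (simp add: frac_def)
  then have "(SOME p. p \<in> frac a b) \<in> frac a b" by (rule someI)
  then obtain c d where p: "(SOME p. p \<in> frac a b) = (c, d)"
    and c: "c \<in> carrier R" "d \<in> carrier R - {\<zero>}" and eq: "a \<otimes> d = c \<otimes> b"
    by (auto simp: frac_def)
  have "F c d = F (c \<otimes> b) (d \<otimes> b)" using c ab by (simp add: F)
  also have "\<dots> = F (a \<otimes> d) (b \<otimes> d)" using c ab eq by (simp add: m_comm)
  also have "\<dots> = F a b" using c ab by (simp add: F)
  finally show ?thesis by (simp add: frac_lift_def p)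
qed

lemma frac_in_fracs: "a \<in> carrier R \<Longrightarrow> b \<in> carrier R - {\<zero>} \<Longrightarrow> frac a b \<in> carrier fracs"
  by (auto simp: fracs_def)

lemma fracsE:
  assumes "X \<in> carrier fracs"
  obtains a b where "a \<in> carrier R" "b \<in> carrier R - {\<zero>}" "X = frac a b"
  using assms by (auto simp: fracs_def)

lemma zero_fracs: "b \<in> carrier R - {\<zero>} \<Longrightarrow> \<zero>\<^bsub>fracs\<^esub> = frac \<zero> b"
  by (simp add: fracs_def frac_eq_iff)

lemma smult_frac:
  assumes "r \<in> carrier R" "a \<in> carrier R" "b \<in> carrier R - {\<zero>}"
  shows "r \<odot>\<^bsub>fracs\<^esub> frac a b = frac (r \<otimes> a) b"
proof -
  have "frac (r \<otimes> (a \<otimes> c)) (b \<otimes> c) = frac (r \<otimes> a) b"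
    if "a \<in> carrier R" "b \<in> carrier R - {\<zero>}" "c \<in> carrier R - {\<zero>}" for a b c
    using that assms(1) frac_cancel[of "r \<otimes> a" b c] by (simp add: m_assoc)
  then have "frac_lift (\<lambda>a b. frac (r \<otimes> a) b) (frac a b) = frac (r \<otimes> a) b"
    using assms by (intro frac_lift_frac) auto
  then show ?thesis by (simp add: fracs_def)
qed

text \<open>\<open>fracs\<close> lifts the addition formula in two nested stages, so each argument
  needs invariance under expansion: \<open>r\<close> gives it for the second fraction, and
  \<open>r'\<close> follows for the first by exchanging the two fractions.\<close>

lemma add_frac:
  assumes "a \<in> carrier R" "b \<in> carrier R - {\<zero>}" "c \<in> carrier R" "d \<in> carrier R - {\<zero>}"
  shows "frac a b \<oplus>\<^bsub>fracs\<^esub> frac c d = frac (a \<otimes> d \<oplus> c \<otimes> b) (b \<otimes> d)"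
proof -
  have r: "frac (a \<otimes> (d \<otimes> e) \<oplus> (c \<otimes> e) \<otimes> b) (b \<otimes> (d \<otimes> e)) = frac (a \<otimes> d \<oplus> c \<otimes> b) (b \<otimes> d)"
    if "a \<in> carrier R" "b \<in> carrier R - {\<zero>}" "c \<in> carrier R" "d \<in> carrier R - {\<zero>}"
      "e \<in> carrier R - {\<zero>}" for a b c d e
  proof -
    have "a \<otimes> (d \<otimes> e) \<oplus> (c \<otimes> e) \<otimes> b = (a \<otimes> d \<oplus> c \<otimes> b) \<otimes> e" "b \<otimes> (d \<otimes> e) = (b \<otimes> d) \<otimes> e"
      using that by (auto simp: l_distr r_distr m_ac)
    then show ?thesis using that by (simp add: frac_cancel integral_iff)
  qed
  have l: "frac_lift (\<lambda>c d. frac (a \<otimes> d \<oplus> c \<otimes> b) (b \<otimes> d)) (frac c d) = frac (a \<otimes> d \<oplus> c \<otimes> b) (b \<otimes> d)"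
    if "a \<in> carrier R" "b \<in> carrier R - {\<zero>}" for a b
    using that assms by (intro frac_lift_frac) (simp_all only: r)
  have r': "frac (a \<otimes> e \<otimes> d \<oplus> c \<otimes> (b \<otimes> e)) (b \<otimes> e \<otimes> d) = frac (a \<otimes> d \<oplus> c \<otimes> b) (b \<otimes> d)"
    if "a \<in> carrier R" "b \<in> carrier R - {\<zero>}" "e \<in> carrier R - {\<zero>}" for a b e
    using r[of c d a b e] that assms by (simp add: m_ac a_comm)
  have "frac_lift (\<lambda>a b. frac_lift (\<lambda>c d. frac (a \<otimes> d \<oplus> c \<otimes> b) (b \<otimes> d)) (frac c d)) (frac a b) =
      frac_lift (\<lambda>c d. frac (a \<otimes> d \<oplus> c \<otimes> b) (b \<otimes> d)) (frac c d)"
    using assms by (intro frac_lift_frac) (simp_all add: l r' integral_iff)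
  also have "\<dots> = frac (a \<otimes> d \<oplus> c \<otimes> b) (b \<otimes> d)" using assms by (simp add: l)
  finally show ?thesis by (simp add: fracs_def)
qed

section \<open>Common denominators and the module axioms\<close>

lemma add_frac_same:
  assumes "a \<in> carrier R" "b \<in> carrier R - {\<zero>}" "c \<in> carrier R"
  shows "frac a b \<oplus>\<^bsub>fracs\<^esub> frac c b = frac (a \<oplus> c) b"
  using assms by (simp add: add_frac frac_cancel flip: l_distr)

text \<open>If \<open>X\<close> is a / d, it equals (a b) / (b d), with \<open>d\<close> as the
  factor \<open>c\<close>. The last conclusion rewrites every fraction over \<open>b\<close> at
  once, so the lemma also applies to a fraction joining several that already share
  \<open>b\<close>.\<close>

lemma common_denominator:
  assumes "X \<in> carrier fracs" "b \<in> carrier R - {\<zero>}"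
  obtains a c where "a \<in> carrier R" "c \<in> carrier R - {\<zero>}" "X = frac a (b \<otimes> c)"
    "\<And>e. e \<in> carrier R \<Longrightarrow> frac e b = frac (e \<otimes> c) (b \<otimes> c)"
proof -
  obtain a d where "a \<in> carrier R" "d \<in> carrier R - {\<zero>}" "X = frac a d" using fracsE[OF assms(1)] .
  with assms that[of "a \<otimes> b" d] show thesis
    by (metis (no_types, lifting) DiffD1 frac_cancel m_closed m_comm)
qed

lemma common_denominator2:
  assumes "X \<in> carrier fracs" "Y \<in> carrier fracs"
  obtains a b d where "a \<in> carrier R" "b \<in> carrier R" "d \<in> carrier R - {\<zero>}"
    "X = frac a d" "Y = frac b d"
proof -
  obtain b d where *: "b \<in> carrier R" "d \<in> carrier R - {\<zero>}" "Y = frac b d" using fracsE[OF assms(2)] .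
  obtain a c where "a \<in> carrier R" "c \<in> carrier R - {\<zero>}" "X = frac a (d \<otimes> c)"
    "\<And>e. e \<in> carrier R \<Longrightarrow> frac e d = frac (e \<otimes> c) (d \<otimes> c)"
    using common_denominator[OF assms(1) *(2)] by metis
  with * show thesis by (intro that[of a "b \<otimes> c" "d \<otimes> c"]) (simp_all add: integral_iff)
qed

lemma common_denominator3:
  assumes "X \<in> carrier fracs" "Y \<in> carrier fracs" "Z \<in> carrier fracs"
  obtains a b c d where "a \<in> carrier R" "b \<in> carrier R" "c \<in> carrier R" "d \<in> carrier R - {\<zero>}"
    "X = frac a d" "Y = frac b d" "Z = frac c d"
proof -
  obtain b c d where *: "b \<in> carrier R" "c \<in> carrier R" "d \<in> carrier R - {\<zero>}" "Y = frac b d" "Z = frac c d"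
    using common_denominator2[OF assms(2,3)] .
  obtain a e where "a \<in> carrier R" "e \<in> carrier R - {\<zero>}" "X = frac a (d \<otimes> e)"
    "\<And>f. f \<in> carrier R \<Longrightarrow> frac f d = frac (f \<otimes> e) (d \<otimes> e)"
    using common_denominator[OF assms(1) *(3)] by metis
  with * show thesis
    by (intro that[of a "b \<otimes> e" "c \<otimes> e" "d \<otimes> e"]) (simp_all add: integral_iff)
qed

text \<open>Over a common denominator each axiom becomes a ring identity between numerators.\<close>

lemma fracs_module: "module R fracs"
proof (rule moduleI)
  show "abelian_group fracs"
  proof (rule abelian_groupI)
    fix X Y Z assume XYZ: "X \<in> carrier fracs" "Y \<in> carrier fracs" "Z \<in> carrier fracs"
    show "X \<oplus>\<^bsub>fracs\<^esub> Y \<oplus>\<^bsub>fracs\<^esub> Z = X \<oplus>\<^bsub>fracs\<^esub> (Y \<oplus>\<^bsub>fracs\<^esub> Z)"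
      by (rule common_denominator3[OF XYZ]) (simp add: add_frac_same a_assoc)
  next
    fix X Y assume XY: "X \<in> carrier fracs" "Y \<in> carrier fracs"
    show "X \<oplus>\<^bsub>fracs\<^esub> Y \<in> carrier fracs" "X \<oplus>\<^bsub>fracs\<^esub> Y = Y \<oplus>\<^bsub>fracs\<^esub> X"
      by (rule common_denominator2[OF XY], simp add: add_frac_same a_comm frac_in_fracs)+
  next
    fix X assume X: "X \<in> carrier fracs"
    then obtain a b where ab: "a \<in> carrier R" "b \<in> carrier R - {\<zero>}" "X = frac a b" by (rule fracsE)
    then show "\<zero>\<^bsub>fracs\<^esub> \<oplus>\<^bsub>fracs\<^esub> X = X"
      using zero_fracs[OF ab(2)] by (simp add: add_frac_same)
    show "\<exists>Y\<in>carrier fracs. Y \<oplus>\<^bsub>fracs\<^esub> X = \<zero>\<^bsub>fracs\<^esub>"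
      using ab zero_fracs[OF ab(2)]
      by (intro bexI[of _ "frac (\<ominus> a) b"]) (auto simp: add_frac_same l_neg intro!: frac_in_fracs)
  next
    show "\<zero>\<^bsub>fracs\<^esub> \<in> carrier fracs" by (simp add: zero_fracs[of \<one>] frac_in_fracs)
  qed
next
  fix a X Y assume a: "a \<in> carrier R" and XY: "X \<in> carrier fracs" "Y \<in> carrier fracs"
  show "a \<odot>\<^bsub>fracs\<^esub> (X \<oplus>\<^bsub>fracs\<^esub> Y) = a \<odot>\<^bsub>fracs\<^esub> X \<oplus>\<^bsub>fracs\<^esub> a \<odot>\<^bsub>fracs\<^esub> Y"
    by (rule common_denominator2[OF XY]) (simp add: a add_frac_same smult_frac r_distr)
next
  fix a X assume a: "a \<in> carrier R" and X: "X \<in> carrier fracs"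
  show "a \<odot>\<^bsub>fracs\<^esub> X \<in> carrier fracs"
    by (rule fracsE[OF X]) (simp add: a smult_frac frac_in_fracs)
next
  fix a b X assume r: "a \<in> carrier R" "b \<in> carrier R" and X: "X \<in> carrier fracs"
  show "(a \<oplus> b) \<odot>\<^bsub>fracs\<^esub> X = a \<odot>\<^bsub>fracs\<^esub> X \<oplus>\<^bsub>fracs\<^esub> b \<odot>\<^bsub>fracs\<^esub> X"
    by (rule fracsE[OF X]) (simp add: r smult_frac add_frac_same l_distr)
  show "(a \<otimes> b) \<odot>\<^bsub>fracs\<^esub> X = a \<odot>\<^bsub>fracs\<^esub> (b \<odot>\<^bsub>fracs\<^esub> X)"
    by (rule fracsE[OF X]) (simp add: r smult_frac m_assoc)
next
  fix X assume X: "X \<in> carrier fracs"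
  show "\<one> \<odot>\<^bsub>fracs\<^esub> X = X" by (rule fracsE[OF X]) (simp add: smult_frac)
next
  show "cring R" by (rule is_cring)
qed

end

section \<open>The quotient rule and pole orders\<close>

context derivation
begin

text \<open>In \<^locale>\<open>diff_op\<close> the unqualified names below refer to the polynomial ring.\<close>

lemmas pow_Suc_R = nat_pow_Suc add.nat_pow_Suc
lemmas m_comm_R = m_comm
lemmas m_ac_R = m_assoc m_comm m_lcomm
lemmas l_minus_R = l_minus
lemmas r_minus_R = r_minus
lemmas ring_R = ring_axioms
lemmas cring_R = is_cring

text \<open>This is the power rule multiplied through by \<open>x\<close>, which avoids the exponent
  n - 1 and so covers n = 0.\<close>

lemma der_pow: assumes "x \<in> carrier R"
  shows "\<delta> (x [^] (n::nat)) \<otimes> x = ([n] \<cdot> \<one>) \<otimes> (x [^] n) \<otimes> \<delta> x"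
proof (induction n)
  case (Suc n)
  have c: "x [^] n \<in> carrier R" "\<delta> x \<in> carrier R" "\<delta> (x [^] n) \<in> carrier R" "[n] \<cdot> \<one> \<in> carrier R"
    using assms by auto
  have "\<delta> (x [^] Suc n) \<otimes> x = (\<delta> (x [^] n) \<otimes> x) \<otimes> x \<oplus> (x [^] n) \<otimes> \<delta> x \<otimes> x"
    using assms c by (simp add: der_mult l_distr)
  also have "\<dots> = ([n] \<cdot> \<one> \<oplus> \<one>) \<otimes> (x [^] n \<otimes> x) \<otimes> \<delta> x"
    unfolding Suc using assms c by algebra
  finally show ?case by simp
qed (use assms in simp)

end

section \<open>Extending the derivation to fractions\<close>

locale diff_op_domain = diff_op R \<delta> P + domain R for R (structure) and \<delta> and P (structure)
begin

definition frac_der :: "('a \<times> 'a) set \<Rightarrow> ('a \<times> 'a) set"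
  where "frac_der = frac_lift (\<lambda>a b. frac (\<delta> a \<otimes> b \<ominus> a \<otimes> \<delta> b) (b \<otimes> b))"

text \<open>Expanding a / b by \<open>c\<close> multiplies numerator and denominator of the quotient
  rule by \<open>c \<otimes> c\<close>, since the terms containing \<delta>(c) cancel.\<close>

lemma frac_der_frac:
  assumes "a \<in> carrier R" "b \<in> carrier R - {\<zero>}"
  shows "frac_der (frac a b) = frac (\<delta> a \<otimes> b \<ominus> a \<otimes> \<delta> b) (b \<otimes> b)"
  unfolding frac_der_def
proof (rule frac_lift_frac)
  fix a b c assume abc: "a \<in> carrier R" "b \<in> carrier R - {\<zero>}" "c \<in> carrier R - {\<zero>}"
  then have "a \<in> carrier R" "b \<in> carrier R" "c \<in> carrier R" "\<delta> a \<in> carrier R" "\<delta> b \<in> carrier R" "\<delta> c \<in> carrier R"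
    by auto
  then have "\<delta> (a \<otimes> c) \<otimes> (b \<otimes> c) \<ominus> a \<otimes> c \<otimes> \<delta> (b \<otimes> c) = (\<delta> a \<otimes> b \<ominus> a \<otimes> \<delta> b) \<otimes> (c \<otimes> c)"
    and "b \<otimes> c \<otimes> (b \<otimes> c) = b \<otimes> b \<otimes> (c \<otimes> c)"
    by ((simp only: der_mult)?, algebra)+
  then show "frac (\<delta> (a \<otimes> c) \<otimes> (b \<otimes> c) \<ominus> a \<otimes> c \<otimes> \<delta> (b \<otimes> c)) (b \<otimes> c \<otimes> (b \<otimes> c)) =
      frac (\<delta> a \<otimes> b \<ominus> a \<otimes> \<delta> b) (b \<otimes> b)"
    using abc by (simp add: frac_cancel integral_iff)
qed (use assms in auto)

lemma frac_der_const: "a \<in> carrier R \<Longrightarrow> frac_der (frac a \<one>) = frac (\<delta> a) \<one>"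
  by (simp add: frac_der_frac a_minus_def)

lemma differential_module_fracs: "differential_module R \<delta> fracs frac_der"
proof (intro differential_module.intro fracs_module differential_module_axioms.intro)
  show "diff_op R \<delta>" by unfold_locales
next
  fix X assume X: "X \<in> carrier fracs"
  show "frac_der X \<in> carrier fracs"
    by (rule fracsE[OF X]) (simp add: frac_der_frac frac_in_fracs integral_iff)
next
  fix X Y assume X: "X \<in> carrier fracs" "Y \<in> carrier fracs"
  show "frac_der (X \<oplus>\<^bsub>fracs\<^esub> Y) = frac_der X \<oplus>\<^bsub>fracs\<^esub> frac_der Y"
  proof (rule common_denominator2[OF X])
    fix a b d assume *: "a \<in> carrier R" "b \<in> carrier R" "d \<in> carrier R - {\<zero>}" "X = frac a d" "Y = frac b d"
    then have "d \<in> carrier R" "\<delta> a \<in> carrier R" "\<delta> b \<in> carrier R" "\<delta> d \<in> carrier R" by auto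
    with *(1,2) have "\<delta> (a \<oplus> b) \<otimes> d \<ominus> (a \<oplus> b) \<otimes> \<delta> d = (\<delta> a \<otimes> d \<ominus> a \<otimes> \<delta> d) \<oplus> (\<delta> b \<otimes> d \<ominus> b \<otimes> \<delta> d)"
      by (simp only: der_add, algebra)
    then show ?thesis using * by (simp add: add_frac_same frac_der_frac integral_iff)
  qed
next
  fix r X assume r: "r \<in> carrier R" and X: "X \<in> carrier fracs"
  show "frac_der (r \<odot>\<^bsub>fracs\<^esub> X) = \<delta> r \<odot>\<^bsub>fracs\<^esub> X \<oplus>\<^bsub>fracs\<^esub> r \<odot>\<^bsub>fracs\<^esub> frac_der X"
  proof (rule fracsE[OF X])
    fix a d assume *: "a \<in> carrier R" "d \<in> carrier R - {\<zero>}" "X = frac a d"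
    then have "d \<in> carrier R" "\<delta> a \<in> carrier R" "\<delta> r \<in> carrier R" "\<delta> d \<in> carrier R" using r by auto
    with *(1) r have "\<delta> (r \<otimes> a) \<otimes> d \<ominus> (r \<otimes> a) \<otimes> \<delta> d = (\<delta> r \<otimes> a) \<otimes> d \<oplus> r \<otimes> (\<delta> a \<otimes> d \<ominus> a \<otimes> \<delta> d)"
      by (simp only: der_mult, algebra)
    \<comment> \<open>The term without a derivative of the fraction is brought to the denominator
      \<open>d \<otimes> d\<close> of the quotient rule.\<close>
    moreover have "frac (\<delta> r \<otimes> a) d = frac (\<delta> r \<otimes> a \<otimes> d) (d \<otimes> d)"
      using * r frac_cancel[of "\<delta> r \<otimes> a" d d] by simp
    ultimately show ?thesis using * r by (simp add: add_frac_same smult_frac frac_der_frac integral_iff)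
  qed
qed

end

sublocale diff_op_domain \<subseteq> fr: differential_module R \<delta> P fracs frac_der
  by (rule differential_module_fracs, rule P_def)

section \<open>Poles along x and their derivatives\<close>

locale diff_op_pole = diff_op_domain + 
  fixes x assumes x: "x \<in> carrier R - {\<zero>}"
begin

lemma x_closed [simp]: "x \<in> carrier R" and x_nonzero [simp]: "x \<noteq> \<zero>"
  using x by auto

lemma x_pow_nonzero [simp]: "x [^] (n::nat) \<noteq> \<zero>"
  by (induction n) (auto simp: integral_iff)

text \<open>The quotient rule yields the denominator \<open>X \<otimes> X\<close>. After
  multiplication by \<open>x\<close> the numerator acquires a factor \<open>X\<close> by
  \<open>der_pow\<close>, so one differentiation raises the exponent of the denominator only by
  one.\<close>

lemma frac_der_pole: assumes c: "c \<in> carrier R"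
  shows "frac_der (frac c (x [^] n)) = frac (x \<otimes> \<delta> c \<ominus> ([n] \<cdot> \<one>) \<otimes> (\<delta> x \<otimes> c)) (x [^] Suc n)"
proof -
  define X k where "X = x [^] n" "k = [n] \<cdot> \<one>"
  have cl: "X \<in> carrier R" "k \<in> carrier R" "\<delta> X \<in> carrier R" "\<delta> x \<in> carrier R" "\<delta> c \<in> carrier R" "X \<noteq> \<zero>"
    using c by (auto simp: X_k_def)
  have "(\<delta> c \<otimes> X \<ominus> c \<otimes> \<delta> X) \<otimes> (X \<otimes> x) = \<delta> c \<otimes> X \<otimes> X \<otimes> x \<ominus> c \<otimes> X \<otimes> (\<delta> X \<otimes> x)"
    using c cl x_closed by algebra
  also have "\<delta> X \<otimes> x = k \<otimes> X \<otimes> \<delta> x"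
    using der_pow[of x n] by (simp add: X_k_def)
  also have "\<delta> c \<otimes> X \<otimes> X \<otimes> x \<ominus> c \<otimes> X \<otimes> (k \<otimes> X \<otimes> \<delta> x) = (x \<otimes> \<delta> c \<ominus> k \<otimes> (\<delta> x \<otimes> c)) \<otimes> (X \<otimes> X)"
    using c cl x_closed by algebra
  finally show ?thesis
    using c cl by (simp add: frac_der_frac frac_eq_iff integral_iff flip: X_k_def)
qed

text \<open>The coefficient of \<open>x\<^sup>-\<^sup>n\<^sup>-\<^sup>1\<close> in the \<open>n\<close>-th derivative of \<open>q / x\<close>, modulo \<open>x\<close>.\<close>

primrec lead :: "'a \<Rightarrow> nat \<Rightarrow> 'a"
  where "lead q 0 = q"
  | "lead q (Suc n) = \<ominus> (([Suc n] \<cdot> \<one>) \<otimes> (\<delta> x \<otimes> lead q n))"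

lemma lead_closed [simp]: "q \<in> carrier R \<Longrightarrow> lead q n \<in> carrier R"
  by (induction n) (auto simp del: pow_Suc_R)

text \<open>By \<open>frac_der_pole\<close>, differentiating the pole below \<open>lead q n\<close>
  contributes the next \<open>lead\<close>; everything else in the new numerator is a multiple of
  \<open>x\<close>.\<close>

lemma frac_der_pow:
  assumes q: "q \<in> carrier R"
  shows "\<exists>r\<in>carrier R. (frac_der ^^ n) (frac q x) = frac (lead q n \<oplus> x \<otimes> r) (x [^] Suc n)"
proof (induction n)
  case 0
  show ?case using q by (intro bexI[of _ \<zero>]) auto
next
  case (Suc n)
  then obtain r where r: "r \<in> carrier R"
    "(frac_der ^^ n) (frac q x) = frac (lead q n \<oplus> x \<otimes> r) (x [^] Suc n)" by blast
  \<comment> \<open>The integer is n + 1 because the fraction to be differentiated has denominator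
    \<open>x [^] Suc n\<close>.\<close>
  define k t where "k = [Suc n] \<cdot> \<one>" "t = lead q n"
  have cl: "k \<in> carrier R" "t \<in> carrier R" "\<delta> t \<in> carrier R" "\<delta> r \<in> carrier R" "\<delta> x \<in> carrier R"
    using q r by (auto simp: k_t_def simp del: pow_Suc_R)
  have "x \<otimes> \<delta> (t \<oplus> x \<otimes> r) \<ominus> k \<otimes> (\<delta> x \<otimes> (t \<oplus> x \<otimes> r)) =
      x \<otimes> (\<delta> t \<oplus> (\<delta> x \<otimes> r \<oplus> x \<otimes> \<delta> r)) \<ominus> k \<otimes> (\<delta> x \<otimes> (t \<oplus> x \<otimes> r))"
    using cl r by (simp add: der_add der_mult)
  also have "\<dots> = \<ominus> (k \<otimes> (\<delta> x \<otimes> t)) \<oplus> x \<otimes> (\<delta> t \<oplus> \<delta> x \<otimes> r \<oplus> x \<otimes> \<delta> r \<ominus> k \<otimes> (\<delta> x \<otimes> r))"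
    using cl r(1) x_closed by algebra
  finally have eq: "x \<otimes> \<delta> (t \<oplus> x \<otimes> r) \<ominus> k \<otimes> (\<delta> x \<otimes> (t \<oplus> x \<otimes> r)) =
      lead q (Suc n) \<oplus> x \<otimes> (\<delta> t \<oplus> \<delta> x \<otimes> r \<oplus> x \<otimes> \<delta> r \<ominus> k \<otimes> (\<delta> x \<otimes> r))"
    by (simp only: lead.simps k_t_def)
  have "(frac_der ^^ Suc n) (frac q x) = frac_der (frac (t \<oplus> x \<otimes> r) (x [^] Suc n))"
    using r(2) by (simp add: k_t_def)
  also have "\<dots> = frac (x \<otimes> \<delta> (t \<oplus> x \<otimes> r) \<ominus> k \<otimes> (\<delta> x \<otimes> (t \<oplus> x \<otimes> r))) (x [^] Suc (Suc n))"
    unfolding k_t_def(1) using cl r by (intro frac_der_pole) auto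
  finally show ?case unfolding eq by (rule bexI) (use cl r in simp)
qed

text \<open>The union over \<open>n\<close> of these sets is the \<open>S\<close>-submodule generated by \<open>Q / x\<close>; writing the
  operators \<open>\<theta>\<^sup>n\<close> to the left of the coefficients avoids any \<open>\<delta>\<close>-stability of \<open>Q\<close>.\<close>

primrec pole_sums :: "'a set \<Rightarrow> nat \<Rightarrow> ('a \<times> 'a) set set"
  where "pole_sums Q 0 = (\<lambda>q. frac q x) ` Q"
  | "pole_sums Q (Suc n) =
      {v \<oplus>\<^bsub>fracs\<^esub> (frac_der ^^ Suc n) (frac q x) | v q. v \<in> pole_sums Q n \<and> q \<in> Q}"

lemma frac_x_in_fracs [simp]: "q \<in> carrier R \<Longrightarrow> frac q x \<in> carrier fracs"
  by (simp add: frac_in_fracs)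

lemma pole_sums_carrier: assumes "Q \<subseteq> carrier R" shows "pole_sums Q n \<subseteq> carrier fracs"
  using assms by (induction n) (auto simp del: funpow.simps simp: subset_iff)

text \<open>Differentiating q / x at most n times creates poles of order at most n + 1, so the whole
  sum fits over one denominator.\<close>

lemma pole_sums_frac:
  assumes Q: "Q \<subseteq> carrier R" and v: "v \<in> pole_sums Q n"
  shows "\<exists>c\<in>carrier R. v = frac c (x [^] Suc n)"
  using v
proof (induction n arbitrary: v)
  case 0
  then show ?case using Q by auto
next
  case (Suc n)
  then obtain w q where wq: "w \<in> pole_sums Q n" "q \<in> Q"
    "v = w \<oplus>\<^bsub>fracs\<^esub> (frac_der ^^ Suc n) (frac q x)" by (auto simp del: funpow.simps)
  obtain c where c: "c \<in> carrier R" "w = frac c (x [^] Suc n)" using Suc.IH[OF wq(1)] by blast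
  then have w: "w = frac (c \<otimes> x) (x [^] Suc (Suc n))"
    using frac_cancel[of c "x [^] Suc n" x] by (simp add: integral_iff)
  have q: "q \<in> carrier R" using wq(2) Q by blast
  obtain r where r: "r \<in> carrier R"
    "(frac_der ^^ Suc n) (frac q x) = frac (lead q (Suc n) \<oplus> x \<otimes> r) (x [^] Suc (Suc n))"
    using frac_der_pow[OF q, of "Suc n"] by blast
  have "v = frac (c \<otimes> x \<oplus> (lead q (Suc n) \<oplus> x \<otimes> r)) (x [^] Suc (Suc n))"
    unfolding wq(3) w r(2) using c(1) q r(1) by (intro add_frac_same) (auto simp: integral_iff)
  then show ?case by (rule bexI) (use c(1) q r(1) in simp)
qed

lemma frac_der_pow_zero: "(frac_der ^^ n) (frac \<zero> x) = \<zero>\<^bsub>fracs\<^esub>"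
  by (induction n) (auto simp flip: zero_fracs[OF x])

section \<open>The submodule generated by Q / x\<close>

context
  fixes Q assumes Q: "ideal Q R"
begin

interpretation Q: ideal Q R by (rule Q)

lemma pole_sums_closed: "v \<in> pole_sums Q n \<Longrightarrow> v \<in> carrier fracs"
  using pole_sums_carrier[of Q] Q.a_subset by blast

lemma frac_pow_closed: "q \<in> Q \<Longrightarrow> (frac_der ^^ n) (frac q x) \<in> carrier fracs"
  by (simp add: Q.Icarr)

text \<open>The additional summand may be taken with coefficient zero.\<close>

lemma pole_sums_Suc: "pole_sums Q n \<subseteq> pole_sums Q (Suc n)"
proof
  fix v assume v: "v \<in> pole_sums Q n"
  then have "v = v \<oplus>\<^bsub>fracs\<^esub> (frac_der ^^ Suc n) (frac \<zero> x)"
    using pole_sums_closed by (simp add: frac_der_pow_zero del: funpow.simps)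
  then show "v \<in> pole_sums Q (Suc n)" using v Q.zero_closed by (subst pole_sums.simps) blast
qed

lemma pole_sums_mono: "m \<le> n \<Longrightarrow> pole_sums Q m \<subseteq> pole_sums Q n"
  by (rule lift_Suc_mono_le[of "pole_sums Q"]) (rule pole_sums_Suc)

lemma frac_der_pow_add: "p \<in> Q \<Longrightarrow> q \<in> Q \<Longrightarrow> (frac_der ^^ n) (frac p x) \<oplus>\<^bsub>fracs\<^esub> (frac_der ^^ n) (frac q x) =
    (frac_der ^^ n) (frac (p \<oplus> q) x)"
  by (simp add: Q.Icarr add_frac_same flip: fr.D_pow_add)

lemma pole_sums_add: "v \<in> pole_sums Q n \<Longrightarrow> w \<in> pole_sums Q n \<Longrightarrow> v \<oplus>\<^bsub>fracs\<^esub> w \<in> pole_sums Q n"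
proof (induction n arbitrary: v w)
  case 0
  then show ?case by (auto simp: Q.Icarr add_frac_same)
next
  case (Suc n)
  let ?d = "\<lambda>q. (frac_der ^^ Suc n) (frac q x)"
  obtain v' p where v: "v' \<in> pole_sums Q n" "p \<in> Q" "v = v' \<oplus>\<^bsub>fracs\<^esub> ?d p"
    using Suc.prems(1) by (auto simp del: funpow.simps)
  obtain w' q where w: "w' \<in> pole_sums Q n" "q \<in> Q" "w = w' \<oplus>\<^bsub>fracs\<^esub> ?d q"
    using Suc.prems(2) by (auto simp del: funpow.simps)
  note cl = pole_sums_closed[OF v(1)] pole_sums_closed[OF w(1)]
    frac_pow_closed[OF v(2), of "Suc n"] frac_pow_closed[OF w(2), of "Suc n"]
  have "v \<oplus>\<^bsub>fracs\<^esub> w = (v' \<oplus>\<^bsub>fracs\<^esub> w') \<oplus>\<^bsub>fracs\<^esub> (?d p \<oplus>\<^bsub>fracs\<^esub> ?d q)"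
    unfolding v(3) w(3) using cl by (simp add: fr.V.M.a_ac del: funpow.simps)
  also have "?d p \<oplus>\<^bsub>fracs\<^esub> ?d q = ?d (p \<oplus> q)" using v w by (intro frac_der_pow_add)
  finally show ?case using Suc.IH[OF v(1) w(1)] v w Q.a_closed by auto
qed

lemma frac_der_pow_in_pole_sums: "q \<in> Q \<Longrightarrow> (frac_der ^^ n) (frac q x) \<in> pole_sums Q n"
proof (cases n)
  case (Suc m)
  assume q: "q \<in> Q"
  have "frac \<zero> x \<in> pole_sums Q m" using pole_sums_mono[of 0 m] Q.zero_closed by auto
  moreover have "frac \<zero> x \<oplus>\<^bsub>fracs\<^esub> (frac_der ^^ n) (frac q x) = (frac_der ^^ n) (frac q x)"
    using frac_pow_closed[OF q] by (simp flip: zero_fracs[OF x])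
  ultimately show ?thesis using q unfolding Suc pole_sums.simps mem_Collect_eq by metis
qed auto

lemma pole_sums_der: "v \<in> pole_sums Q n \<Longrightarrow> frac_der v \<in> pole_sums Q (Suc n)"
proof (induction n arbitrary: v)
  case 0
  then show ?case using frac_der_pow_in_pole_sums[of _ "Suc 0"] by auto
next
  case (Suc n)
  then obtain w q where wq: "w \<in> pole_sums Q n" "q \<in> Q"
    "v = w \<oplus>\<^bsub>fracs\<^esub> (frac_der ^^ Suc n) (frac q x)" by (auto simp del: funpow.simps)
  have "frac_der v = frac_der w \<oplus>\<^bsub>fracs\<^esub> (frac_der ^^ Suc (Suc n)) (frac q x)"
    unfolding wq(3) using pole_sums_closed[OF wq(1)] frac_pow_closed[OF wq(2), of "Suc n"]
    by (simp add: fr.D_add)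
  then show ?case using Suc.IH[OF wq(1)] wq(2) by (subst pole_sums.simps) blast
qed

text \<open>The relation a \<theta> = \<theta> a - \<delta>(a) moves the scalar to the right of the
  operator, where the ideal \<open>Q\<close> absorbs it. The induction keeps \<open>a\<close>
  arbitrary because the correction term carries the scalar - \<delta>(a).\<close>

lemma pole_sums_smult_der: "a \<in> carrier R \<Longrightarrow> q \<in> Q \<Longrightarrow>
    a \<odot>\<^bsub>fracs\<^esub> (frac_der ^^ n) (frac q x) \<in> pole_sums Q n"
proof (induction n arbitrary: a)
  case 0
  then show ?case using Q.I_l_closed by (auto simp: smult_frac Q.Icarr)
next
  case (Suc n)
  let ?v = "(frac_der ^^ n) (frac q x)"
  have v: "?v \<in> carrier fracs" using Suc.prems(2) by (rule frac_pow_closed)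
  have "a \<odot>\<^bsub>fracs\<^esub> frac_der ?v = frac_der (a \<odot>\<^bsub>fracs\<^esub> ?v) \<oplus>\<^bsub>fracs\<^esub> (\<ominus> \<delta> a) \<odot>\<^bsub>fracs\<^esub> ?v"
  proof -
    have "frac_der (a \<odot>\<^bsub>fracs\<^esub> ?v) = \<delta> a \<odot>\<^bsub>fracs\<^esub> ?v \<oplus>\<^bsub>fracs\<^esub> a \<odot>\<^bsub>fracs\<^esub> frac_der ?v"
      using v Suc.prems by (intro fr.D_smult)
    moreover have "(\<ominus> \<delta> a) \<odot>\<^bsub>fracs\<^esub> ?v = \<ominus>\<^bsub>fracs\<^esub> (\<delta> a \<odot>\<^bsub>fracs\<^esub> ?v)"
      using v Suc.prems by (simp add: fr.V.smult_l_minus)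
    moreover have "w = u \<oplus>\<^bsub>fracs\<^esub> w \<oplus>\<^bsub>fracs\<^esub> \<ominus>\<^bsub>fracs\<^esub> u"
      if "u \<in> carrier fracs" "w \<in> carrier fracs" for u w
      using that by (simp add: fr.V.M.a_comm[of u w] fr.V.M.a_assoc fr.V.M.r_neg)
    ultimately show ?thesis using v Suc.prems(1) by simp
  qed
  moreover have "frac_der (a \<odot>\<^bsub>fracs\<^esub> ?v) \<in> pole_sums Q (Suc n)"
    by (rule pole_sums_der[OF Suc.IH[OF Suc.prems]])
  moreover have "(\<ominus> \<delta> a) \<odot>\<^bsub>fracs\<^esub> ?v \<in> pole_sums Q (Suc n)"
    using pole_sums_Suc Suc.IH[of "\<ominus> \<delta> a"] Suc.prems by auto
  ultimately have "a \<odot>\<^bsub>fracs\<^esub> frac_der ?v \<in> pole_sums Q (Suc n)"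
    by (simp only: pole_sums_add)
  then show ?case by (simp del: pole_sums.simps)
qed

lemma pole_sums_smult: "a \<in> carrier R \<Longrightarrow> v \<in> pole_sums Q n \<Longrightarrow> a \<odot>\<^bsub>fracs\<^esub> v \<in> pole_sums Q n"
proof (induction n arbitrary: v)
  case 0
  then show ?case using Q.I_l_closed by (auto simp: smult_frac Q.Icarr)
next
  case (Suc n)
  then obtain w q where wq: "w \<in> pole_sums Q n" "q \<in> Q"
    "v = w \<oplus>\<^bsub>fracs\<^esub> (frac_der ^^ Suc n) (frac q x)" by (auto simp del: funpow.simps)
  have "a \<odot>\<^bsub>fracs\<^esub> v = a \<odot>\<^bsub>fracs\<^esub> w \<oplus>\<^bsub>fracs\<^esub> a \<odot>\<^bsub>fracs\<^esub> (frac_der ^^ Suc n) (frac q x)"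
    unfolding wq(3) using Suc.prems(1) pole_sums_closed[OF wq(1)] frac_pow_closed[OF wq(2), of "Suc n"]
    by (rule fr.V.smult_r_distr)
  moreover have "a \<odot>\<^bsub>fracs\<^esub> w \<in> pole_sums Q (Suc n)" using Suc.IH Suc.prems wq pole_sums_Suc by blast
  ultimately show ?case
    using pole_sums_add pole_sums_smult_der[OF Suc.prems(1) wq(2)] by (simp del: pole_sums.simps funpow.simps)
qed

lemma submodule_pole_sums: "submodule (\<Union>n. pole_sums Q n) S fr.diff_mod"
  unfolding fr.submodule_diff_mod_iff
proof (intro conjI ballI)
  show "(\<Union>n. pole_sums Q n) \<subseteq> carrier fracs" using pole_sums_closed by blast
  have "frac \<zero> x \<in> pole_sums Q 0" using Q.zero_closed by auto
  then show "\<zero>\<^bsub>fracs\<^esub> \<in> (\<Union>n. pole_sums Q n)" unfolding zero_fracs[OF x] by blast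
next
  fix v w assume "v \<in> (\<Union>n. pole_sums Q n)" "w \<in> (\<Union>n. pole_sums Q n)"
  then obtain m n where "v \<in> pole_sums Q m" "w \<in> pole_sums Q n" by blast
  then have "v \<oplus>\<^bsub>fracs\<^esub> w \<in> pole_sums Q (max m n)"
    using pole_sums_mono[of m "max m n"] pole_sums_mono[of n "max m n"] by (intro pole_sums_add) auto
  then show "v \<oplus>\<^bsub>fracs\<^esub> w \<in> (\<Union>n. pole_sums Q n)" by blast
next
  fix a v assume "a \<in> carrier R" "v \<in> (\<Union>n. pole_sums Q n)"
  then show "a \<odot>\<^bsub>fracs\<^esub> v \<in> (\<Union>n. pole_sums Q n)" using pole_sums_smult by blast
next
  fix v assume "v \<in> (\<Union>n. pole_sums Q n)"
  then show "frac_der v \<in> (\<Union>n. pole_sums Q n)" using pole_sums_der by blast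
qed

end

end

section \<open>Comparing pole orders\<close>

context diff_op_pole
begin

text \<open>Up to sign \<open>lead q n\<close> is n! \<delta>(x)^n q; \<open>char\<close> and
  \<open>reg\<close> strip off the integer factors and the factors \<delta>(x) one at a
  time.\<close>

lemma lead_divides:
  assumes reg: "\<And>r. \<lbrakk>r \<in> carrier R; x divides \<delta> x \<otimes> r\<rbrakk> \<Longrightarrow> x divides r"
    and char: "\<And>n r. \<lbrakk>r \<in> carrier R; x divides ([Suc n] \<cdot> \<one>) \<otimes> r\<rbrakk> \<Longrightarrow> x divides r"
    and q: "q \<in> carrier R" and "x divides lead q n"
  shows "x divides q"
  using assms(4)
proof (induction n)
  case (Suc n)
  let ?t = "([Suc n] \<cdot> \<one>) \<otimes> (\<delta> x \<otimes> lead q n)"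
  have t: "?t \<in> carrier R" using q by auto
  obtain c where c: "c \<in> carrier R" "\<ominus> ?t = x \<otimes> c" using Suc.prems by (auto simp: factor_def simp del: pow_Suc_R)
  have "?t = x \<otimes> \<ominus> c" using arg_cong[OF c(2), of "a_inv R"] t c(1) by (simp add: r_minus_R del: pow_Suc_R)
  then have "x divides ?t" using c(1) by (auto simp: factor_def simp del: pow_Suc_R)
  then have "x divides \<delta> x \<otimes> lead q n" by (rule char[rotated]) (use q in simp)
  then have "x divides lead q n" by (rule reg[rotated]) (use q in simp)
  then show ?case by (rule Suc.IH)
qed simp

text \<open>The top term \<open>D\<^sup>n(q / x)\<close> has a pole of order \<open>n + 1\<close> unless \<open>x\<close> divides \<open>q\<close>, and if it does
  then the term is \<open>y / 1 = x y / x\<close>, which can be moved to the bottom since \<open>x \<in> Q\<close>.\<close>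

lemma frac_in_pole_sums_imp:
  assumes reg: "\<And>r. \<lbrakk>r \<in> carrier R; x divides \<delta> x \<otimes> r\<rbrakk> \<Longrightarrow> x divides r"
    and char: "\<And>n r. \<lbrakk>r \<in> carrier R; x divides ([Suc n] \<cdot> \<one>) \<otimes> r\<rbrakk> \<Longrightarrow> x divides r"
    and Q: "ideal Q R" "x \<in> Q" and b: "b \<in> carrier R" and "frac b x \<in> pole_sums Q n"
  shows "b \<in> Q"
  using assms(6)
proof (induction n)
  case 0
  then obtain q where q: "q \<in> Q" "frac b x = frac q x" by auto
  then have "q \<in> carrier R" using ideal.Icarr[OF Q(1)] by blast
  with b q show ?case by (simp add: frac_eq_iff m_rcancel)
next
  case (Suc n)
  interpret Q: ideal Q R by (rule Q(1))
  obtain w q where wq: "w \<in> pole_sums Q n" "q \<in> Q"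
    "frac b x = w \<oplus>\<^bsub>fracs\<^esub> (frac_der ^^ Suc n) (frac q x)" using Suc.prems by (auto simp del: funpow.simps)
  have q: "q \<in> carrier R" using wq(2) by (rule Q.Icarr)
  obtain c where c: "c \<in> carrier R" "w = frac c (x [^] Suc n)"
    using pole_sums_frac[OF Q.a_subset wq(1)] by blast
  define t X where "t = lead q (Suc n)" and "X = x [^] n"
  have tX: "t \<in> carrier R" "X \<in> carrier R" "X \<noteq> \<zero>" "x [^] Suc n = X \<otimes> x"
    "x [^] Suc (Suc n) = X \<otimes> x \<otimes> x" unfolding t_def X_def using q by (rule_tac lead_closed, assumption, auto)
  obtain r where r: "r \<in> carrier R"
    "(frac_der ^^ Suc n) (frac q x) = frac (t \<oplus> x \<otimes> r) (X \<otimes> x \<otimes> x)"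
    using frac_der_pow[OF q, of "Suc n"] unfolding tX(5) t_def by blast
  \<comment> \<open>The lower terms have a pole of order at most n + 1; expanding by
    \<open>x\<close> puts them over the denominator of order n + 2 of the top derivative.\<close>
  have w: "w = frac (c \<otimes> x) (X \<otimes> x \<otimes> x)"
    unfolding c(2) tX(4) using c tX by (subst frac_cancel) (auto simp: integral_iff)
  have "frac b x = frac (c \<otimes> x \<oplus> (t \<oplus> x \<otimes> r)) (X \<otimes> x \<otimes> x)"
    unfolding wq(3) w r(2) using c(1) r(1) tX by (intro add_frac_same) (auto simp: integral_iff)
  \<comment> \<open>Clearing denominators and cancelling one \<open>x\<close> leaves n + 1 factors
    \<open>x\<close> next to \<open>b\<close>. At least one survives, so \<open>t\<close> is a
    difference of multiples of \<open>x\<close>.\<close>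
  then have "b \<otimes> (X \<otimes> x \<otimes> x) = (c \<otimes> x \<oplus> (t \<oplus> x \<otimes> r)) \<otimes> x"
    using b c r tX by (simp add: frac_eq_iff integral_iff)
  moreover have "b \<otimes> (X \<otimes> x \<otimes> x) = (b \<otimes> X \<otimes> x) \<otimes> x"
    using b tX x_closed by algebra
  ultimately have "b \<otimes> X \<otimes> x = c \<otimes> x \<oplus> (t \<oplus> x \<otimes> r)"
    using b c r tX by (simp add: m_rcancel)
  moreover have "t = (c \<otimes> x \<oplus> (t \<oplus> x \<otimes> r)) \<ominus> (c \<otimes> x \<oplus> x \<otimes> r)"
    using c(1) r(1) tX(1) x_closed by algebra
  ultimately have "t = b \<otimes> X \<otimes> x \<ominus> (c \<otimes> x \<oplus> x \<otimes> r)" by simp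
  also have "\<dots> = x \<otimes> (b \<otimes> X \<ominus> c \<ominus> r)"
    using b c(1) r(1) tX(2) x_closed by algebra
  finally have "x divides t" unfolding factor_def using b c(1) r(1) tX(2) by blast
  then have lead: "x divides lead q (Suc n)" unfolding t_def .
  have "x divides q" by (rule lead_divides[OF _ _ q lead]) (fact reg char)+
  then obtain s where s: "s \<in> carrier R" "q = x \<otimes> s" by (auto simp: factor_def)
  have "frac q x = frac s \<one>" using s x by (simp add: frac_eq_iff m_comm_R)
  \<comment> \<open>Once q / x lies in \<open>R\<close>, so do all its derivatives.\<close>
  moreover have "\<exists>y\<in>carrier R. (frac_der ^^ m) (frac s \<one>) = frac y \<one>" for m
    by (induction m) (use s frac_der_const in auto)
  ultimately obtain y where y: "y \<in> carrier R" "(frac_der ^^ Suc n) (frac q x) = frac y \<one>" by metis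
  have "frac y \<one> = frac (x \<otimes> y) x" using y x by (simp add: frac_eq_iff m_comm_R)
  moreover have "x \<otimes> y \<in> Q" using Q.I_r_closed Q(2) y by blast
  ultimately have "frac y \<one> \<in> pole_sums Q n" using pole_sums_mono[OF Q(1), of 0 n] by auto
  then have "frac b x \<in> pole_sums Q n"
    unfolding wq(3) y(2) by (rule pole_sums_add[OF Q(1) wq(1)])
  then show ?case by (rule Suc.IH)
qed

lemma pole_sums_subset: assumes "Q \<subseteq> Q'" shows "pole_sums Q n \<subseteq> pole_sums Q' n"
proof (induction n)
  case (Suc n)
  then show ?case using assms unfolding pole_sums.simps by blast
qed (use assms in auto)

lemma frac_orbit:
  "q \<in> carrier R \<Longrightarrow> frac q x \<in> (\<lambda>s. s \<odot>\<^bsub>fr.diff_mod\<^esub> frac \<one> x) ` carrier S"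
  by (rule image_eqI[of _ _ "monom P q 0"]) (auto simp: fr.act_monom smult_frac)

text \<open>The orbit of 1 / x is a submodule, hence closed under sums and \<open>frac_der\<close>,
  and it contains every q / x. This places the descending chain inside the cyclic module.\<close>

lemma pole_sums_orbit:
  assumes "Q \<subseteq> carrier R"
  shows "pole_sums Q n \<subseteq> (\<lambda>s. s \<odot>\<^bsub>fr.diff_mod\<^esub> frac \<one> x) ` carrier S"
proof -
  define C where "C = (\<lambda>s. s \<odot>\<^bsub>fr.diff_mod\<^esub> frac \<one> x) ` carrier S"
  have "submodule C S fr.diff_mod"
    unfolding C_def by (rule left_module.submodule_orbit[OF fr.left_module_diff_mod]) simp
  note C = this[unfolded fr.submodule_diff_mod_iff]
  have add: "v \<oplus>\<^bsub>fracs\<^esub> w \<in> C" if "v \<in> C" "w \<in> C" for v w using C that by blast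
  have der: "frac_der v \<in> C" if "v \<in> C" for v using C that by blast
  have base: "frac q x \<in> C" if "q \<in> Q" for q
    unfolding C_def using that assms by (intro frac_orbit) auto
  have pow: "(frac_der ^^ m) (frac q x) \<in> C" if "q \<in> Q" for q m
    by (induction m) (auto simp: base that der)
  have "pole_sums Q n \<subseteq> C"
    by (induction n) (auto simp: base intro!: add pow simp del: funpow.simps)
  then show ?thesis by (simp only: C_def)
qed

end

section \<open>The base ring as an essential simple submodule\<close>

context diff_op_domain
begin

abbreviation const_fracs :: "('a \<times> 'a) set set" where "const_fracs \<equiv> (\<lambda>a. frac a \<one>) ` carrier R"

lemma frac_one_eq_iff: "a \<in> carrier R \<Longrightarrow> b \<in> carrier R \<Longrightarrow> frac a \<one> = frac b \<one> \<longleftrightarrow> a = b"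
  by (simp add: frac_eq_iff)

lemma zero_fracs_one: "\<zero>\<^bsub>fracs\<^esub> = frac \<zero> \<one>"
  by (simp add: zero_fracs[of \<one>])

lemma submodule_const_fracs: "submodule const_fracs S fr.diff_mod"
  unfolding fr.submodule_diff_mod_iff
proof (intro conjI ballI)
  show "\<zero>\<^bsub>fracs\<^esub> \<in> const_fracs" unfolding zero_fracs_one by (intro imageI) simp
qed (auto simp: add_frac_same smult_frac frac_der_const frac_in_fracs)

text \<open>A submodule of the copy of \<open>R\<close> is the image of an ideal. Since
  \<open>frac_der\<close> restricts to \<delta> there, this ideal is a \<delta>-ideal, and
  \<delta>-simplicity leaves only the two trivial cases.\<close>

lemma simple_const_fracs:
  assumes "delta_simple R \<delta>"
  shows "simple_module S (fr.diff_mod\<lparr>carrier := const_fracs\<rparr>)"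
  unfolding left_module.simple_submodule_iff[OF fr.left_module_diff_mod submodule_const_fracs]
proof (intro conjI allI impI)
  show "const_fracs \<noteq> {\<zero>\<^bsub>fr.diff_mod\<^esub>}"
    using frac_one_eq_iff[of \<one> \<zero>] by (auto simp: zero_fracs_one)
next
  fix H assume H: "submodule H S fr.diff_mod \<and> H \<subseteq> const_fracs"
  note cl = conjunct1[OF H, unfolded fr.submodule_diff_mod_iff]
  define I where "I = {a \<in> carrier R. frac a \<one> \<in> H}"
  have HI: "H = (\<lambda>a. frac a \<one>) ` I" using H by (auto simp: I_def)
  have add: "a \<oplus> b \<in> I" if "a \<in> I" "b \<in> I" for a b
  proof -
    have "frac a \<one> \<oplus>\<^bsub>fracs\<^esub> frac b \<one> \<in> H" using cl that unfolding I_def by blast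
    then show ?thesis using that by (simp add: I_def add_frac_same)
  qed
  have mult: "r \<otimes> a \<in> I" if "a \<in> I" "r \<in> carrier R" for a r
  proof -
    have "r \<odot>\<^bsub>fracs\<^esub> frac a \<one> \<in> H" using cl that unfolding I_def by blast
    then show ?thesis using that by (simp add: I_def smult_frac)
  qed
  have I: "I \<subseteq> carrier R" by (auto simp: I_def)
  have inv: "\<ominus> a \<in> I" if "a \<in> I" for a
  proof -
    have "\<ominus> a = (\<ominus> \<one>) \<otimes> a" using that I l_minus_R[of \<one> a] by auto
    then show ?thesis using mult[OF that] by simp
  qed
  have "ideal I R"
  proof (rule idealI)
    show "subgroup I (add_monoid R)"
    proof
      show "\<one>\<^bsub>add_monoid R\<^esub> \<in> I" using cl by (simp add: I_def zero_fracs_one)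
      show "inv\<^bsub>add_monoid R\<^esub> a \<in> I" if "a \<in> I" for a using inv[OF that] by (simp add: a_inv_def)
    qed (use I add in simp_all)
    show "a \<otimes> r \<in> I" if "a \<in> I" "r \<in> carrier R" for a r
      using mult[OF that] that I by (metis m_comm_R subsetD)
  qed (use mult ring_R in auto)
  moreover have "\<delta> a \<in> I" if "a \<in> I" for a
  proof -
    have "frac_der (frac a \<one>) \<in> H" using cl that unfolding I_def by blast
    then show ?thesis using that by (simp add: I_def frac_der_const)
  qed
  ultimately have "I = {\<zero>} \<or> I = carrier R"
    using assms unfolding delta_simple_def delta_ideal_def by blast
  then show "H = {\<zero>\<^bsub>fr.diff_mod\<^esub>} \<or> H = const_fracs"
  proof
    assume "I = {\<zero>}"
    then have "H = {frac \<zero> \<one>}" by (simp only: HI image_insert image_empty)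
    then show ?thesis by (simp only: fr.diff_mod_simps zero_fracs_one simp_thms)
  qed (simp add: HI)
qed

text \<open>Multiplying a nonzero a / b in \<open>H\<close> by its denominator \<open>b\<close>
  gives the nonzero constant \<open>a\<close> in \<open>H\<close>.\<close>

lemma const_fracs_essential:
  assumes "submodule H S fr.diff_mod" "H \<noteq> {\<zero>\<^bsub>fr.diff_mod\<^esub>}"
  shows "H \<inter> const_fracs \<noteq> {\<zero>\<^bsub>fr.diff_mod\<^esub>}"
proof -
  note cl = assms(1)[unfolded fr.submodule_diff_mod_iff]
  obtain v where v: "v \<in> H" "v \<noteq> \<zero>\<^bsub>fracs\<^esub>" proof -
    have "\<zero>\<^bsub>fracs\<^esub> \<in> H" "H \<noteq> {\<zero>\<^bsub>fracs\<^esub>}" using cl assms(2) by simp_all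
    then show thesis using that by blast
  qed
  then have "v \<in> carrier fracs" using cl by blast
  then obtain a b where ab: "a \<in> carrier R" "b \<in> carrier R - {\<zero>}" "v = frac a b"
    by (rule fracsE)
  have "b \<odot>\<^bsub>fracs\<^esub> v \<in> H" using cl v(1) ab(2) by blast
  also have "b \<odot>\<^bsub>fracs\<^esub> v = frac a \<one>" using ab by (simp add: smult_frac frac_eq_iff m_comm_R)
  finally have "frac a \<one> \<in> H \<inter> const_fracs" using ab(1) by blast
  moreover have "a \<noteq> \<zero>" using v(2) ab zero_fracs[OF ab(2)] by auto
  then have "frac a \<one> \<noteq> \<zero>\<^bsub>fracs\<^esub>" using ab(1) by (simp add: zero_fracs_one frac_one_eq_iff)
  ultimately show ?thesis by auto
qed

end

section \<open>Strictly descending chains of ideals and of submodules\<close>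

lemma (in primeideal) pow_in_imp:
  assumes "a \<in> carrier R" "a [^] (n::nat) \<in> I" shows "a \<in> I"
  using assms(2)
proof (induction n)
  case 0
  then show ?case using one_imp_carrier I_notcarr by auto
next
  case (Suc n)
  then show ?case using I_prime[of "a [^] n" a] assms(1) by auto
qed

text \<open>The set is the sum of \<open>I\<close> and the principal ideal of \<open>c\<close>; the
  explicit form exposes the coefficients used in the computation with \<open>Q n\<close>.\<close>

lemma (in cring) ideal_add_multiples:
  assumes "ideal I R" "c \<in> carrier R"
  shows "ideal {p \<oplus> r \<otimes> c | p r. p \<in> I \<and> r \<in> carrier R} R"
proof -
  have "{p \<oplus> r \<otimes> c | p r. p \<in> I \<and> r \<in> carrier R} = I <+> PIdl c"
    unfolding set_add_def' cgenideal_def by blast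
  then show ?thesis using add_ideals[OF assms(1) cgenideal_ideal[OF assms(2)]] by simp
qed

text \<open>\<open>reg\<close> says that \<delta>(x) is a nonzerodivisor modulo \<open>x\<close>,
  and \<open>char\<close> says the same of the positive integers. In this form both alternatives for
  \<open>x\<close> are treated alike.\<close>

lemma (in diff_op_pole) not_property_diamond:
  assumes simple: "delta_simple R \<delta>"
    and reg: "\<And>r. \<lbrakk>r \<in> carrier R; x divides \<delta> x \<otimes> r\<rbrakk> \<Longrightarrow> x divides r"
    and char: "\<And>n r. \<lbrakk>r \<in> carrier R; x divides ([Suc n] \<cdot> \<one>) \<otimes> r\<rbrakk> \<Longrightarrow> x divides r"
    and I: "primeideal I R" "\<not> maximalideal I R" "x \<in> I"
  shows "\<not> property_diamond S"
proof -
  interpret I: primeideal I R by (rule I(1))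
  \<comment> \<open>Being prime but not maximal, \<open>I\<close> lies strictly inside a proper
    ideal \<open>J\<close>. Any \<open>b\<close> in \<open>J\<close> outside \<open>I\<close>
    serves: its powers generate a strictly descending chain of ideals modulo
    \<open>I\<close>.\<close>
  obtain J where J: "ideal J R" "I \<subseteq> J" "J \<noteq> I" "J \<noteq> carrier R"
    using I(2) I.I_notcarr maximalidealI[OF I.ideal_axioms] by auto
  interpret J: ideal J R by (rule J(1))
  obtain b where b: "b \<in> J" "b \<notin> I" using J by blast
  have bR: "b \<in> carrier R" using b(1) by (rule J.Icarr)
  define Q where "Q n = {p \<oplus> r \<otimes> b [^] n | p r. p \<in> I \<and> r \<in> carrier R}" for n :: nat
  have Q: "ideal (Q n) R" for n
    unfolding Q_def by (rule cring.ideal_add_multiples[OF cring_R I.ideal_axioms]) (use bR in simp)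
  have QR: "Q n \<subseteq> carrier R" for n using ideal.Icarr[OF Q] by blast
  have IQ: "p \<in> Q n" if "p \<in> I" for p n
  proof -
    have "p = p \<oplus> \<zero> \<otimes> b [^] n" using I.Icarr[OF that] bR by simp
    then show ?thesis unfolding Q_def using that by blast
  qed
  have dec: "Q (Suc n) \<subseteq> Q n" for n
  proof
    fix q assume "q \<in> Q (Suc n)"
    then obtain p r where "p \<in> I" "r \<in> carrier R" "q = p \<oplus> r \<otimes> b [^] Suc n" unfolding Q_def by blast
    moreover from this have "r \<otimes> b [^] Suc n = (r \<otimes> b) \<otimes> b [^] n" using bR by (simp add: m_ac_R)
    ultimately show "q \<in> Q n" unfolding Q_def using bR by auto
  qed
  \<comment> \<open>Otherwise b^n (1 - r b) lies in the prime ideal \<open>I\<close>. If b^n is in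
    \<open>I\<close>, so is \<open>b\<close>, against its choice. If 1 - r b is in \<open>I\<close>,
    it is in \<open>J\<close>, and adding r b from \<open>J\<close> puts 1 into the proper ideal
    \<open>J\<close>.\<close>
  have strict: "b [^] n \<notin> Q (Suc n)" for n
  proof
    assume "b [^] n \<in> Q (Suc n)"
    then obtain p r where p: "p \<in> I" "r \<in> carrier R" "b [^] n = p \<oplus> r \<otimes> (b [^] n \<otimes> b)"
      unfolding Q_def by auto
    define B where "B = b [^] n"
    have c: "B \<in> carrier R" "p \<in> carrier R" using bR p(1) I.Icarr by (auto simp: B_def)
    have "B \<otimes> (u \<ominus> r \<otimes> b) = B \<otimes> u \<ominus> r \<otimes> (B \<otimes> b)" if "u \<in> carrier R" for u
      using c bR p(2) that by algebra
    from this[of \<one>] have "B \<otimes> (\<one> \<ominus> r \<otimes> b) = B \<ominus> r \<otimes> (B \<otimes> b)"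
      using c by simp
    also have "\<dots> = (p \<oplus> r \<otimes> (B \<otimes> b)) \<ominus> r \<otimes> (B \<otimes> b)" using p(3) by (simp add: B_def)
    also have "\<dots> = p" using c bR p(2) by algebra
    finally have "B \<in> I \<or> \<one> \<ominus> r \<otimes> b \<in> I" using I.I_prime c bR p by auto
    then have "\<one> \<ominus> r \<otimes> b \<in> J" using I.pow_in_imp[OF bR] b(2) J(2) unfolding B_def by blast
    moreover have "r \<otimes> b \<in> J" using b(1) p(2) by (rule J.I_l_closed)
    ultimately have "(\<one> \<ominus> r \<otimes> b) \<oplus> r \<otimes> b \<in> J" by (rule J.a_closed)
    also have "(\<one> \<ominus> r \<otimes> b) \<oplus> r \<otimes> b = \<one>" using bR p(2) by algebra
    finally show False using J.one_imp_carrier J(4) by blast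
  qed
  let ?H = "\<lambda>n. \<Union>m. pole_sums (Q n) m"
  \<comment> \<open>The cyclic extension is the orbit of 1 / x, and the n-th member of the chain is
    the submodule generated by \<open>Q n\<close> / x.\<close>
  show ?thesis
  proof (rule left_module.not_property_diamondI[OF fr.left_module_diff_mod _ refl submodule_const_fracs _
        simple_const_fracs[OF simple] const_fracs_essential, where m = "frac \<one> x" and H = ?H])
    show "frac \<one> x \<in> carrier fr.diff_mod" by simp
    \<comment> \<open>Writing a as (a x) / x places the copy of \<open>R\<close> inside the orbit of
      1 / x.\<close>
    have "frac a \<one> = frac (a \<otimes> x) x" if "a \<in> carrier R" for a
      using that by (simp add: frac_eq_iff)
    then show "const_fracs \<subseteq> (\<lambda>s. s \<odot>\<^bsub>fr.diff_mod\<^esub> frac \<one> x) ` carrier S"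
      using frac_orbit by (auto simp del: fr.diff_mod_simps S_simps)
  next
    fix n
    show "submodule (?H n) S fr.diff_mod" by (rule submodule_pole_sums[OF Q])
    show "?H n \<subseteq> (\<lambda>s. s \<odot>\<^bsub>fr.diff_mod\<^esub> frac \<one> x) ` carrier S"
      using pole_sums_orbit[OF QR] by blast
    have "?H (Suc n) \<subseteq> ?H n" using pole_sums_subset[OF dec] by blast
    \<comment> \<open>The fraction b^n / x separates consecutive members: it occurs at stage 0 for
      \<open>Q n\<close>, while pole comparison excludes it for \<open>Q (Suc n)\<close>.\<close>
    moreover have "b [^] n = \<zero> \<oplus> \<one> \<otimes> b [^] n" using bR by simp
    then have "b [^] n \<in> Q n" unfolding Q_def using I.zero_closed by blast
    then have "frac (b [^] n) x \<in> pole_sums (Q n) 0" by simp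
    then have "frac (b [^] n) x \<in> ?H n" by blast
    moreover have "frac (b [^] n) x \<notin> ?H (Suc n)"
    proof
      assume "frac (b [^] n) x \<in> ?H (Suc n)"
      then obtain m where m: "frac (b [^] n) x \<in> pole_sums (Q (Suc n)) m" by blast
      \<comment> \<open>Pole comparison applies because \<open>x\<close> lies in \<open>I\<close>
        and hence in every \<open>Q n\<close>.\<close>
      have "b [^] n \<in> Q (Suc n)"
      proof (rule frac_in_pole_sums_imp[OF _ _ Q IQ[OF I(3)] _ m])
      qed (fact reg char | use bR in simp)+
      with strict show False by blast
    qed
    ultimately show "?H (Suc n) \<subset> ?H n" by blast
  qed
qed

section \<open>Units and divisibility from the hypotheses on K, R and x\<close>

lemma (in algebra) nat_Units:
  assumes "field R" and "[n] \<cdot>\<^bsub>R\<^esub> \<one>\<^bsub>R\<^esub> \<noteq> \<zero>\<^bsub>R\<^esub>"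
  shows "[(n::nat)] \<cdot>\<^bsub>M\<^esub> \<one>\<^bsub>M\<^esub> \<in> Units M"
proof -
  interpret F: field R by (rule assms(1))
  \<comment> \<open>The integer n in the algebra is the image of n in the field, so the image of its
    inverse in the field inverts it.\<close>
  have eq: "[n] \<cdot>\<^bsub>M\<^esub> \<one>\<^bsub>M\<^esub> = ([n] \<cdot>\<^bsub>R\<^esub> \<one>\<^bsub>R\<^esub>) \<odot>\<^bsub>M\<^esub> \<one>\<^bsub>M\<^esub>" for n :: nat
    by (induction n) (auto simp: smult_l_distr)
  define k where "k = [n] \<cdot>\<^bsub>R\<^esub> \<one>\<^bsub>R\<^esub>"
  have k: "k \<in> carrier R" "inv\<^bsub>R\<^esub> k \<in> carrier R" "k \<otimes>\<^bsub>R\<^esub> inv\<^bsub>R\<^esub> k = \<one>\<^bsub>R\<^esub>"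
    using assms(2) F.field_Units by (auto simp: k_def)
  then have "(k \<odot>\<^bsub>M\<^esub> \<one>\<^bsub>M\<^esub>) \<otimes>\<^bsub>M\<^esub> (inv\<^bsub>R\<^esub> k \<odot>\<^bsub>M\<^esub> \<one>\<^bsub>M\<^esub>) = \<one>\<^bsub>M\<^esub>"
    by (simp add: smult_assoc2 flip: smult_assoc1)
  then show ?thesis
    unfolding eq k_def[symmetric] using k by (auto simp: Units_def m_comm intro!: bexI[of _ "inv\<^bsub>R\<^esub> k \<odot>\<^bsub>M\<^esub> \<one>\<^bsub>M\<^esub>"])
qed

lemma (in cring) Units_divides_cancel:
  assumes "u \<in> Units R" "r \<in> carrier R" "x \<in> carrier R" "x divides u \<otimes> r"
  shows "x divides r"
proof -
  obtain c where c: "c \<in> carrier R" "u \<otimes> r = x \<otimes> c" using assms(4) by (auto simp: factor_def)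
  have "r = inv u \<otimes> (u \<otimes> r)"
    using assms(1,2) by (simp add: Units_closed m_assoc[symmetric])
  also have "\<dots> = x \<otimes> (inv u \<otimes> c)" using assms c by (simp add: Units_closed m_lcomm)
  finally show ?thesis using assms c(1) unfolding factor_def by blast
qed

text \<open>If \<open>x\<close> divided \<delta>(x), the Leibniz rule would make the principal ideal
  of \<open>x\<close> a \<delta>-ideal, yet it is nonzero and, as \<open>x\<close> is not a unit,
  proper.\<close>

lemma (in derivation) delta_simple_not_divides:
  assumes "delta_simple R \<delta>" "x \<in> carrier R" "x \<noteq> \<zero>" "x \<notin> Units R"
  shows "\<not> x divides \<delta> x"
proof
  assume "x divides \<delta> x"
  then obtain d where d: "d \<in> carrier R" "\<delta> x = x \<otimes> d" by (auto simp: factor_def)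
  have "\<delta> (r \<otimes> x) \<in> PIdl x" if "r \<in> carrier R" for r
  proof -
    have "\<delta> (r \<otimes> x) = (\<delta> r \<oplus> r \<otimes> d) \<otimes> x"
      using that assms(2) d by (simp add: der_mult l_distr r_distr m_ac)
    then show ?thesis using that d(1) unfolding cgenideal_def by blast
  qed
  then have "\<delta> ` (PIdl x) \<subseteq> PIdl x" by (auto simp: cgenideal_def)
  then have "PIdl x = {\<zero>} \<or> PIdl x = carrier R"
    using assms(1) cgenideal_ideal[OF assms(2)] unfolding delta_simple_def delta_ideal_def by blast
  moreover have "x \<in> PIdl x" by (rule cgenideal_self[OF assms(2)])
  ultimately have "\<one> \<in> PIdl x" using assms(3) by auto
  then obtain r where "r \<in> carrier R" "\<one> = r \<otimes> x" by (auto simp: cgenideal_def)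
  then have "x \<in> Units R" using assms(2) by (auto simp: Units_def m_comm intro!: bexI[of _ r])
  with assms(4) show False ..
qed

theorem theorem2p4:
  fixes K :: "('k, 'c) ring_scheme"
    and R :: "('k, 'r, 'd) module_scheme"
    and \<delta> :: "'r \<Rightarrow> 'r"
    and x :: 'r
  assumes "field K"
    and "\<forall>n::nat. n > 0 \<longrightarrow> [n] \<cdot>\<^bsub>K\<^esub> \<one>\<^bsub>K\<^esub> \<noteq> \<zero>\<^bsub>K\<^esub>"
    and "algebra K R"
    and "noetherian_ring R"
    and "domain R"
    and "derivation R \<delta>"
    and "delta_simple R \<delta>"
    and "x \<in> carrier R"
    and "\<exists>P. primeideal P R \<and> \<not> maximalideal P R \<and> x \<in> P"
    and "\<delta> x \<in> Units R \<or> ring_prime\<^bsub>R\<^esub> x"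
  shows "\<not> property_diamond (diff_op_ring R \<delta>)"
proof -
  interpret domain R by (rule assms(5))
  interpret derivation R \<delta> by (rule assms(6))
  obtain I where I: "primeideal I R" "\<not> maximalideal I R" "x \<in> I" using assms(9) by blast
  \<comment> \<open>Neither alternative allows zero: \<delta>(0) = 0 is not a unit, and a prime
    element is nonzero.\<close>
  have nz: "x \<noteq> \<zero>\<^bsub>R\<^esub>"
  proof
    assume "x = \<zero>\<^bsub>R\<^esub>"
    then have "\<zero>\<^bsub>R\<^esub> \<in> Units R" using assms(10) by (simp add: ring_prime_def)
    then show False using zero_not_one by (auto simp: Units_def)
  qed
  \<comment> \<open>A unit \<delta>(x) can be cancelled. A prime \<open>x\<close> divides
    \<delta>(x) or \<open>r\<close>, and \<delta>-simplicity rules out the former.\<close>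
  have reg: "x divides\<^bsub>R\<^esub> r" if r: "r \<in> carrier R" "x divides\<^bsub>R\<^esub> \<delta> x \<otimes>\<^bsub>R\<^esub> r" for r
    using assms(10)
  proof
    assume "\<delta> x \<in> Units R"
    then show ?thesis by (rule Units_divides_cancel[OF _ r(1) assms(8) r(2)])
  next
    assume p: "ring_prime\<^bsub>R\<^esub> x"
    then have "x \<notin> Units R" by (simp add: ring_prime_def prime_def)
    then have "\<not> x divides\<^bsub>R\<^esub> \<delta> x"
      using delta_simple_not_divides[OF assms(7,8) nz] by simp
    then show ?thesis using p r assms(8) by (auto simp: ring_prime_def prime_def)
  qed
  \<comment> \<open>Positive integers are invertible in \<open>K\<close>, hence units of
    \<open>R\<close>, and can be cancelled.\<close>
  have char: "x divides\<^bsub>R\<^esub> r"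
    if "r \<in> carrier R" "x divides\<^bsub>R\<^esub> ([Suc n] \<cdot>\<^bsub>R\<^esub> \<one>\<^bsub>R\<^esub>) \<otimes>\<^bsub>R\<^esub> r" for n r
  proof (rule Units_divides_cancel[OF _ that(1) assms(8) that(2)])
    show "[Suc n] \<cdot>\<^bsub>R\<^esub> \<one>\<^bsub>R\<^esub> \<in> Units R"
      using assms(2) by (intro algebra.nat_Units[OF assms(3,1)]) blast
  qed
  interpret diff_op_pole R \<delta> "UP R" x
    by unfold_locales (use assms(8) nz in auto)
  show ?thesis
    by (rule not_property_diamond[OF assms(7) _ _ I]) (fact reg char)+
qed

end
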